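(* Let $\gamma_1,\gamma_2$ be non-zero rational numbers, let $s>\frac{2}{3}$, and let $C,K\in(0,\infty)$. There exists $\varepsilon_*>0$, depending only on $C,K,s,\gamma_1,\gamma_2$, with the following property. Suppose $A\subset[0,1]$ is compact and supports a Borel probability measure $\mu$ such that (1) $\mathcal{J}_{s,\frac{2}{3}}(\mu)=K<\infty$; and (2) $\mu(B(x,r))\le C r^{1-\varepsilon_0}$ for all $x\in\mathbb{R}$ and $r>0$, for some $0<\varepsilon_0\le\varepsilon_*$. Then there exist $x,t\in\mathbb{R}$ with $t\neq0$ such that $$\{x,\;x-\gamma_1t,\;x-\gamma_2t\}\subset A.$$
   Context: For a finite Borel measure $\mu$ on $\mathbb{R}$ with Fourier transform $\widehat\mu$, $s\ge0$ and $\theta\in(0,1]$, the $(s,\theta)$-energy is $$\mathcal{J}_{s,\theta}(\mu)=\Big(\int_{\mathbb{R}}|\widehat{\mu}(\xi)|^{\frac{2}{\theta}}|\xi|^{\frac{s}{\theta}-1}\,d\xi\Big)^{\theta},$$ used here with $\theta=\frac23$. $B(x,r)\subset\mathbb{R}$ is the ball (interval) of radius $r$ centred at $x$. "$A$ supports $\mu$" means that $\mu$ is a Borel probability measure with $\operatorname{supp}\mu\subset A$. *)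

theory Defs
  imports "HOL-Probability.Probability"
begin

text \<open>
  The Fourier transform of a measure with the normalisation
  \<open>\<integral> exp (- 2 \<pi> i \<xi> x) d\<mu>(x)\<close>. The constant \<open>char\<close> is the integral of \<open>exp (i t x)\<close>.
\<close>
definition fourier_measure :: "real measure \<Rightarrow> real \<Rightarrow> complex" where
  "fourier_measure \<mu> \<xi> = char \<mu> (- (2 * pi * \<xi>))"

definition ennreal_rpow :: "ennreal \<Rightarrow> real \<Rightarrow> ennreal" where
  "ennreal_rpow x p = (if x = \<top> then \<top> else ennreal (enn2real x powr p))"

text \<open>
  The energy takes values in the extended nonnegative reals, so a divergent integral gives \<open>\<top>\<close>.
  Since \<open>0 powr a = 0\<close> for every \<open>a\<close>, the integrand is \<open>0\<close> at \<open>\<xi> = 0\<close> also for a nonpositive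
  exponent; this affects a single point only. \<open>ennreal_rpow\<close> is meant for positive exponents.
\<close>
definition energy :: "real \<Rightarrow> real \<Rightarrow> real measure \<Rightarrow> ennreal" where
  "energy s \<theta> \<mu> =
     ennreal_rpow
       (\<integral>\<^sup>+ \<xi>. ennreal (cmod (fourier_measure \<mu> \<xi>) powr (2 / \<theta>) * \<bar>\<xi>\<bar> powr (s / \<theta> - 1)) \<partial>lborel) \<theta>"

definition measure_support :: "'a::topological_space measure \<Rightarrow> 'a set" where
  "measure_support \<mu> = {x. \<forall>U. open U \<longrightarrow> x \<in> U \<longrightarrow> emeasure \<mu> U > 0}"

text \<open>The locale \<open>real_distribution\<close> describes the Borel probability measures on the real line.\<close>
definition supports :: "real set \<Rightarrow> real measure \<Rightarrow> bool" where
  "supports A \<mu> \<longleftrightarrow> real_distribution \<mu> \<and> measure_support \<mu> \<subseteq> A"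

end

theory Submission
  imports Defs
begin

text \<open>
  Suppose the theorem fails: there are measures \<open>M n\<close>, on sets without configurations, whose ball
  exponents tend to 1. Mollify a measure by a Gaussian of width \<open>\<sigma>\<close> and count the configurations
  of the mollified density against a Gaussian weight in \<open>(x, t)\<close> and the factor \<open>1 - cos t\<close>, which
  suppresses the degenerate configurations \<open>t = 0\<close>. On the Fourier side this count is a trilinear
  form bounded by \<open>L\<^sup>3\<close> norms of the Fourier transforms. The energy is a weighted \<open>L\<^sup>3\<close> norm with a
  positive power of the frequency as weight, so the count is Cauchy as \<open>\<sigma> \<rightarrow> 0\<close>, uniformly over all
  measures of energy \<open>K\<close>. For each \<open>M n\<close> the count tends to 0 as \<open>\<sigma> \<rightarrow> 0\<close>, since there are no
  configurations; hence it is small for all \<open>n\<close> at one common scale \<open>\<sigma>\<close>, and so it is for a weak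
  limit \<open>N\<close>. But \<open>N\<close> satisfies \<open>N (ball x r) \<le> 2 * C * r\<close>, hence dominates a multiple of Lebesgue
  measure on a compact set \<open>E\<close> of positive measure, and the count of \<open>N\<close> is bounded below by
  continuity of translations on \<open>E\<close>, for small \<open>t\<close>. By compactness the argument needs no
  quantitative form of Roth's theorem.
\<close>

subsection \<open>A trilinear form and its \<open>L\<^sup>3\<close> bound\<close>

text \<open>Two requirements on the scale conflict. Absence of configurations makes the count small
  only below a scale that depends on the set, while weak convergence passes to the limit only at a
  fixed scale. The estimate uniform in the measure moves between the two scales, and this is what
  the frequency weight in the energy pays for. The ball condition is used elsewhere: as the
  exponents tend to 1, the limit acquires linear growth, hence no singular part, and this forces a
  positive count. The Gaussian weight in \<open>(x, t)\<close> serves three ends. It is a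
  probability measure, which gives dominated convergence at a fixed scale. Its characteristic
  function is explicit and positive, so the kernel has finite mass in any two frequencies when the
  ratios are nonzero and distinct. Its density is bounded below on compact sets, which the lower
  bound needs.\<close>

lemma (in pair_sigma_finite)
  fixes f :: "'a \<Rightarrow> complex" and g :: "'b \<Rightarrow> complex"
  assumes f: "integrable M1 f" and g: "integrable M2 g"
  shows integrable_pair_times: "integrable (M1 \<Otimes>\<^sub>M M2) (\<lambda>z. f (fst z) * g (snd z))"
    and integral_pair_times:
      "(\<integral>z. f (fst z) * g (snd z) \<partial>(M1 \<Otimes>\<^sub>M M2)) = (\<integral>x. f x \<partial>M1) * (\<integral>y. g y \<partial>M2)"
proof -
  note [measurable] = borel_measurable_integrable[OF f] borel_measurable_integrable[OF g]
  show i: "integrable (M1 \<Otimes>\<^sub>M M2) (\<lambda>z. f (fst z) * g (snd z))"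
    by (rule Fubini_integrable) (use f g in \<open>auto simp: norm_mult\<close>)
  show "(\<integral>z. f (fst z) * g (snd z) \<partial>(M1 \<Otimes>\<^sub>M M2)) = (\<integral>x. f x \<partial>M1) * (\<integral>y. g y \<partial>M2)"
    by (subst integral_fst'[OF i, symmetric]) simp
qed

text \<open>The sign is opposite to that of \<open>char\<close>; the factor 1 / (2 pi) of the
  inversion formula is carried by \<open>mollify_hat\<close>.\<close>

definition inv_fourier :: "(real \<Rightarrow> complex) \<Rightarrow> real \<Rightarrow> complex" where
  "inv_fourier U x = (CLINT a|lborel. U a * iexp (- (a * x)))"

abbreviation gauss_plane :: "(real \<times> real) measure" where
  "gauss_plane \<equiv> std_normal_distribution \<Otimes>\<^sub>M std_normal_distribution"

text \<open>The modulation by \<theta> acts on \<open>t\<close> only and just translates one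
  argument of the kernel below, so the bounds come out uniform in \<theta>. The values used later
  are 0 and 1.\<close>

definition config_form ::
  "real \<Rightarrow> real \<Rightarrow> real \<Rightarrow> (real \<Rightarrow> complex) \<Rightarrow> (real \<Rightarrow> complex) \<Rightarrow> (real \<Rightarrow> complex) \<Rightarrow> complex" where
  "config_form \<gamma>1 \<gamma>2 \<theta> u v w =
     (CLINT z|gauss_plane. iexp (\<theta> * snd z) *
        (u (fst z) * v (fst z - \<gamma>1 * snd z) * w (fst z - \<gamma>2 * snd z)))"

text \<open>The characteristic function of the Gaussian weight at the frequencies that multiply
  \<open>x\<close> and \<open>t\<close> after the three transforms are inserted.\<close>

definition config_kernel :: "real \<Rightarrow> real \<Rightarrow> real \<Rightarrow> real \<Rightarrow> real \<Rightarrow> real \<Rightarrow> real" where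
  "config_kernel \<gamma>1 \<gamma>2 \<theta> a b c = exp (- (a + b + c)\<^sup>2 / 2) * exp (- (\<theta> + \<gamma>1 * b + \<gamma>2 * c)\<^sup>2 / 2)"

lemma measurable_iexp [measurable]: "(\<lambda>x. iexp x) \<in> borel_measurable borel"
  by (intro borel_measurable_continuous_onI continuous_intros)

lemma borel_measurable_inv_fourier [measurable]:
  assumes [measurable]: "U \<in> borel_measurable borel"
  shows "inv_fourier U \<in> borel_measurable borel"
  unfolding inv_fourier_def by measurable

text \<open>Inserting the three transforms gives a phase that is linear in \<open>x\<close> and in
  \<open>t\<close>. Fubini moves the Gaussian integral inside, where it splits into two
  one-dimensional characteristic functions. Absolute integrability is free: all phases have modulus
  1 and the weight has mass 1.\<close>

lemma config_form_inv_fourier: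
  assumes U: "integrable lborel U" and V: "integrable lborel V" and W: "integrable lborel W"
  shows "config_form \<gamma>1 \<gamma>2 \<theta> (inv_fourier U) (inv_fourier V) (inv_fourier W) =
    (CLINT q|lborel \<Otimes>\<^sub>M (lborel \<Otimes>\<^sub>M lborel). U (fst q) * (V (fst (snd q)) * W (snd (snd q))) *
        config_kernel \<gamma>1 \<gamma>2 \<theta> (fst q) (fst (snd q)) (snd (snd q)))"
    and "integrable (lborel \<Otimes>\<^sub>M (lborel \<Otimes>\<^sub>M lborel)) (\<lambda>q. U (fst q) * (V (fst (snd q)) * W (snd (snd q))) *
        config_kernel \<gamma>1 \<gamma>2 \<theta> (fst q) (fst (snd q)) (snd (snd q)))"
proof -
  note [measurable] = borel_measurable_integrable[OF U] borel_measurable_integrable[OF V]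
    borel_measurable_integrable[OF W]
  let ?L2 = "lborel \<Otimes>\<^sub>M lborel :: (real \<times> real) measure"
  let ?L3 = "lborel \<Otimes>\<^sub>M ?L2 :: (real \<times> real \<times> real) measure"
  interpret N: prob_space std_normal_distribution by (rule prob_space_normal_density) simp
  interpret NN: pair_prob_space std_normal_distribution std_normal_distribution ..
  interpret L3: pair_sigma_finite "lborel :: real measure" ?L2 ..
  interpret PL: pair_sigma_finite gauss_plane ?L3 ..
  define e where "e a x = iexp (- (a * x :: real))" for a x
  have [measurable]: "(\<lambda>z. e (fst z) (snd z)) \<in> borel_measurable (borel \<Otimes>\<^sub>M borel)"
    unfolding e_def by measurable
  have [measurable]: "(\<lambda>a. e a x) \<in> borel_measurable borel" for x
    unfolding e_def by measurable
  have ne: "norm (e a x) = 1" for a x by (simp add: e_def)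
  have int: "integrable lborel (\<lambda>a. Z a * e a x)" if "integrable lborel Z" for x and Z :: "real \<Rightarrow> complex"
  proof -
    note [measurable] = borel_measurable_integrable[OF that]
    show ?thesis by (rule Bochner_Integration.integrable_bound[OF that]) (auto simp: norm_mult ne)
  qed
  define H where "H q = U (fst q) * (V (fst (snd q)) * W (snd (snd q)))" for q :: "real \<times> real \<times> real"
  have H: "integrable ?L3 H" unfolding H_def
    by (rule L3.integrable_pair_times[OF U lborel_pair.integrable_pair_times[OF V W]])
  note [measurable] = borel_measurable_integrable[OF H]
  define E where "E z q = e (fst q) (fst z) * (e (fst (snd q)) (fst z - \<gamma>1 * snd z) *
     e (snd (snd q)) (fst z - \<gamma>2 * snd z))" for z :: "real \<times> real" and q :: "real \<times> real \<times> real"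
  have E': "iexp (\<theta> * snd z) * E z q = iexp (- (fst q + fst (snd q) + snd (snd q)) * fst z) *
     iexp ((\<theta> + \<gamma>1 * fst (snd q) + \<gamma>2 * snd (snd q)) * snd z)" for z q
    by (simp add: E_def e_def exp_add[symmetric] algebra_simps)
  have trip: "inv_fourier U (fst z) * inv_fourier V (fst z - \<gamma>1 * snd z) * inv_fourier W (fst z - \<gamma>2 * snd z)
    = (\<integral>q. H q * E z q \<partial>?L3)" for z
  proof -
    have "inv_fourier U (fst z) * (inv_fourier V (fst z - \<gamma>1 * snd z) * inv_fourier W (fst z - \<gamma>2 * snd z))
     = (\<integral>q. (U (fst q) * e (fst q) (fst z)) * 
         ((V (fst (snd q)) * e (fst (snd q)) (fst z - \<gamma>1 * snd z)) * 
          (W (snd (snd q)) * e (snd (snd q)) (fst z - \<gamma>2 * snd z))) \<partial>?L3)"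
      unfolding inv_fourier_def e_def[symmetric]
      by (subst lborel_pair.integral_pair_times[symmetric, OF int[OF V] int[OF W]],
          subst L3.integral_pair_times[symmetric, OF int[OF U] lborel_pair.integrable_pair_times[OF int[OF V] int[OF W]]]) simp
    thus ?thesis by (simp add: H_def E_def mult_ac)
  qed
  define F where "F z q = iexp (\<theta> * snd z) * (H q * E z q)" for z q
  have Feq: "F z q = H q * (iexp (\<theta> * snd z) * E z q)" for z q by (simp add: F_def)
  have meas: "case_prod F \<in> borel_measurable (gauss_plane \<Otimes>\<^sub>M ?L3)"
    unfolding Feq[abs_def] E' by measurable
  have nF: "norm (F z q) = norm (H q)" for z q
    by (simp add: F_def E_def norm_mult ne)
  have Fint: "integrable (gauss_plane \<Otimes>\<^sub>M ?L3) (case_prod F)"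
  proof (rule PL.Fubini_integrable)
    have "integrable ?L3 (\<lambda>q. F z q)" for z
      apply (rule Bochner_Integration.integrable_bound[OF H])
      subgoal unfolding Feq[abs_def] E' by measurable
      subgoal by (simp add: nF)
      done
    thus "AE x in gauss_plane. integrable ?L3 (\<lambda>y. case (x, y) of (x, y) \<Rightarrow> F x y)" by simp
  qed (use meas in \<open>simp_all add: nF\<close>)
  have inner: "(\<integral>z. F z q \<partial>gauss_plane) = H q * config_kernel \<gamma>1 \<gamma>2 \<theta> (fst q) (fst (snd q)) (snd (snd q))" for q
  proof -
    have i: "integrable std_normal_distribution (\<lambda>x. iexp (k * x))" for k
      by (rule N.integrable_const_bound[where B=1]) auto
    have "(\<integral>z. iexp (\<theta> * snd z) * E z q \<partial>gauss_plane) =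
       char std_normal_distribution (- (fst q + fst (snd q) + snd (snd q))) *
       char std_normal_distribution (\<theta> + \<gamma>1 * fst (snd q) + \<gamma>2 * snd (snd q))"
      unfolding char_def E' by (subst NN.integral_pair_times[OF i i]) simp
    also have "\<dots> = config_kernel \<gamma>1 \<gamma>2 \<theta> (fst q) (fst (snd q)) (snd (snd q))"
      unfolding config_kernel_def char_std_normal_distribution by (simp del: minus_add_distrib)
    finally show ?thesis unfolding Feq by simp
  qed
  have "config_form \<gamma>1 \<gamma>2 \<theta> (inv_fourier U) (inv_fourier V) (inv_fourier W) = (\<integral>z. (\<integral>q. F z q \<partial>?L3) \<partial>gauss_plane)"
    unfolding config_form_def trip F_def by simp
  also have "\<dots> = (\<integral>q. (\<integral>z. F z q \<partial>gauss_plane) \<partial>?L3)"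
    by (rule PL.Fubini_integral[symmetric, OF Fint])
  finally show "config_form \<gamma>1 \<gamma>2 \<theta> (inv_fourier U) (inv_fourier V) (inv_fourier W) =
    (CLINT q|?L3. U (fst q) * (V (fst (snd q)) * W (snd (snd q))) *
        config_kernel \<gamma>1 \<gamma>2 \<theta> (fst q) (fst (snd q)) (snd (snd q)))"
    unfolding inner H_def .
  show "integrable ?L3 (\<lambda>q. U (fst q) * (V (fst (snd q)) * W (snd (snd q))) *
        config_kernel \<gamma>1 \<gamma>2 \<theta> (fst q) (fst (snd q)) (snd (snd q)))"
    using PL.integrable_snd[OF Fint] unfolding inner H_def .
qed

section \<open>Gaussian integrals and the cubic bound for the form\<close>

lemma nn_integral_gauss_affine:
  fixes m q :: real
  assumes "m \<noteq> 0"
  shows "(\<integral>\<^sup>+x. ennreal (exp (- (q + m * x)\<^sup>2 / 2)) \<partial>lborel) = ennreal (sqrt (2 * pi) / \<bar>m\<bar>)"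
proof -
  have "(\<integral>\<^sup>+x. ennreal (std_normal_density x) \<partial>lborel) = 1"
    using prob_space.emeasure_space_1[OF prob_space_normal_density[of 1 0]]
    by (simp add: emeasure_density)
  hence "(\<integral>\<^sup>+x. ennreal (sqrt (2 * pi)) * ennreal (std_normal_density x) \<partial>lborel) = ennreal (sqrt (2 * pi))"
    by (subst nn_integral_cmult) auto
  hence "(\<integral>\<^sup>+x. ennreal (exp (- x\<^sup>2 / 2)) \<partial>lborel) = ennreal (sqrt (2 * pi))"
    by (simp add: ennreal_mult'[symmetric] std_normal_density_def)
  also have "(\<integral>\<^sup>+x. ennreal (exp (- x\<^sup>2 / 2)) \<partial>lborel) =
      ennreal \<bar>m\<bar> * (\<integral>\<^sup>+x. ennreal (exp (- (q + m * x)\<^sup>2 / 2)) \<partial>lborel)"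
    by (rule nn_integral_real_affine) (use assms in auto)
  finally have *: "ennreal \<bar>m\<bar> * (\<integral>\<^sup>+x. ennreal (exp (- (q + m * x)\<^sup>2 / 2)) \<partial>lborel) = ennreal (sqrt (2 * pi))" .
  have "(\<integral>\<^sup>+x. ennreal (exp (- (q + m * x)\<^sup>2 / 2)) \<partial>lborel) =
     ennreal (1 / \<bar>m\<bar>) * (ennreal \<bar>m\<bar> * (\<integral>\<^sup>+x. ennreal (exp (- (q + m * x)\<^sup>2 / 2)) \<partial>lborel))"
    using assms by (simp add: mult.assoc[symmetric] ennreal_mult'[symmetric])
  thus ?thesis unfolding * by (simp add: ennreal_mult'[symmetric])
qed

text \<open>Translating \<open>c\<close> by \<open>- p - b\<close> frees the first Gaussian from
  \<open>b\<close>; the second is then affine in \<open>b\<close> with slope \<open>q - r\<close>,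
  so the two integrals can be done one after the other.\<close>

lemma nn_integral_gauss_pair:
  fixes p p' q r :: real
  assumes "q \<noteq> r"
  shows "(\<integral>\<^sup>+b. (\<integral>\<^sup>+c. ennreal (exp (- (p + b + c)\<^sup>2 / 2) * exp (- (p' + q * b + r * c)\<^sup>2 / 2)) \<partial>lborel) \<partial>lborel)
    = ennreal (2 * pi / \<bar>q - r\<bar>)"
proof -
  have "(\<integral>\<^sup>+b. (\<integral>\<^sup>+c. ennreal (exp (- (p + b + c)\<^sup>2 / 2) * exp (- (p' + q * b + r * c)\<^sup>2 / 2)) \<partial>lborel) \<partial>lborel)
    = (\<integral>\<^sup>+b. (\<integral>\<^sup>+c. ennreal (exp (- c\<^sup>2 / 2)) * ennreal (exp (- ((p' - r * p + r * c) + (q - r) * b)\<^sup>2 / 2)) \<partial>lborel) \<partial>lborel)"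
  proof (rule nn_integral_cong)
    fix b
    show "(\<integral>\<^sup>+c. ennreal (exp (- (p + b + c)\<^sup>2 / 2) * exp (- (p' + q * b + r * c)\<^sup>2 / 2)) \<partial>lborel)
      = (\<integral>\<^sup>+c. ennreal (exp (- c\<^sup>2 / 2)) * ennreal (exp (- ((p' - r * p + r * c) + (q - r) * b)\<^sup>2 / 2)) \<partial>lborel)"
      by (subst nn_integral_real_affine[where c=1 and t="- p - b"]) (auto simp: algebra_simps ennreal_mult')
  qed
  also have "\<dots> = (\<integral>\<^sup>+c. (\<integral>\<^sup>+b. ennreal (exp (- c\<^sup>2 / 2)) * ennreal (exp (- ((p' - r * p + r * c) + (q - r) * b)\<^sup>2 / 2)) \<partial>lborel) \<partial>lborel)"
    by (rule lborel_pair.Fubini') auto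
  also have "\<dots> = (\<integral>\<^sup>+c. ennreal (exp (- c\<^sup>2 / 2)) * ennreal (sqrt (2 * pi) / \<bar>q - r\<bar>) \<partial>lborel)"
    by (intro nn_integral_cong, subst nn_integral_cmult, simp)
      (subst nn_integral_gauss_affine, use assms in auto)
  also have "\<dots> = ennreal (sqrt (2 * pi)) * ennreal (sqrt (2 * pi) / \<bar>q - r\<bar>)"
    using nn_integral_gauss_affine[of 1 0] by (subst nn_integral_multc) auto
  also have "\<dots> = ennreal (2 * pi / \<bar>q - r\<bar>)"
    by (simp add: ennreal_mult'[symmetric])
  finally show ?thesis .
qed

definition cube_int :: "(real \<Rightarrow> complex) \<Rightarrow> ennreal" where
  "cube_int U = (\<integral>\<^sup>+a. ennreal (cmod (U a) ^ 3) \<partial>lborel)"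

lemma mult3_le_sum_cubes:
  fixes x y z :: real
  assumes "0 \<le> x" "0 \<le> y" "0 \<le> z"
  shows "x * y * z \<le> x ^ 3 + y ^ 3 + z ^ 3"
proof -
  define m where "m = max x (max y z)"
  have "x * y * z \<le> m * m * m"
    using assms by (intro mult_mono) (auto simp: m_def)
  also have "\<dots> = m ^ 3" by (simp add: power3_eq_cube)
  also have "\<dots> \<le> x ^ 3 + y ^ 3 + z ^ 3"
    using assms by (auto simp: m_def max_def)
  finally show ?thesis .
qed

text \<open>The three masses of \<open>config_kernel\<close> in two frequencies with the third held
  fixed; they depend neither on the fixed frequency nor on \<theta>.\<close>

definition config_const :: "real \<Rightarrow> real \<Rightarrow> real" where
  "config_const \<gamma>1 \<gamma>2 = 2 * pi / \<bar>\<gamma>1\<bar> + 2 * pi / \<bar>\<gamma>2\<bar> + 2 * pi / \<bar>\<gamma>1 - \<gamma>2\<bar>"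

lemma config_const_nonneg: "0 \<le> config_const \<gamma>1 \<gamma>2"
  by (simp add: config_const_def)

lemma measurable_config_kernel [measurable (raw)]:
  assumes [measurable]: "f \<in> borel_measurable M" "g \<in> borel_measurable M" "h \<in> borel_measurable M"
  shows "(\<lambda>z. config_kernel \<gamma>1 \<gamma>2 \<theta> (f z) (g z) (h z)) \<in> borel_measurable M"
  unfolding config_kernel_def by measurable

text \<open>
  The free weights \<open>p\<close>, \<open>q\<close>, \<open>r\<close> of product 1 make smallness of a single one of the three cubic
  norms enough for smallness of the form.
\<close>
lemma config_form_bound:
  assumes \<gamma>: "\<gamma>1 \<noteq> 0" "\<gamma>2 \<noteq> 0" "\<gamma>1 \<noteq> \<gamma>2"
    and U: "integrable lborel U" and V: "integrable lborel V" and W: "integrable lborel W"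
    and pqr: "0 < p" "0 < q" "0 < r" "p * q * r = 1"
  shows "ennreal (cmod (config_form \<gamma>1 \<gamma>2 \<theta> (inv_fourier U) (inv_fourier V) (inv_fourier W))) \<le>
    ennreal (config_const \<gamma>1 \<gamma>2) *
      (ennreal (p ^ 3) * cube_int U + ennreal (q ^ 3) * cube_int V + ennreal (r ^ 3) * cube_int W)"
proof -
  let ?L2 = "lborel \<Otimes>\<^sub>M lborel :: (real \<times> real) measure"
  let ?L3 = "lborel \<Otimes>\<^sub>M ?L2 :: (real \<times> real \<times> real) measure"
  have sL2: "sigma_finite_measure ?L2" unfolding lborel_prod by (rule sigma_finite_lborel)
  note [measurable] = borel_measurable_integrable[OF U] borel_measurable_integrable[OF V]
    borel_measurable_integrable[OF W]
  let ?k = "config_kernel \<gamma>1 \<gamma>2 \<theta>"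
  have k0: "0 \<le> ?k a b c" for a b c by (simp add: config_kernel_def)
  define u v w where "u a = ennreal (p ^ 3 * cmod (U a) ^ 3)" and "v a = ennreal (q ^ 3 * cmod (V a) ^ 3)"
    and "w a = ennreal (r ^ 3 * cmod (W a) ^ 3)" for a
  have [measurable]: "u \<in> borel_measurable borel" "v \<in> borel_measurable borel" "w \<in> borel_measurable borel"
    unfolding u_def v_def w_def by measurable
  \<comment> \<open>With one frequency fixed, the kernel is a nondegenerate Gaussian in the other two, because
    \<open>\<gamma>1\<close>, \<open>\<gamma>2\<close> and \<open>\<gamma>1 - \<gamma>2\<close> are nonzero.\<close>
  have K1: "(\<integral>\<^sup>+b. (\<integral>\<^sup>+c. ?k a b c \<partial>lborel) \<partial>lborel) = 2 * pi / \<bar>\<gamma>1 - \<gamma>2\<bar>" for a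
    using nn_integral_gauss_pair[of \<gamma>1 \<gamma>2 a \<theta>] \<gamma> by (simp add: config_kernel_def)
  have K2: "(\<integral>\<^sup>+a. (\<integral>\<^sup>+c. ?k a b c \<partial>lborel) \<partial>lborel) = 2 * pi / \<bar>\<gamma>2\<bar>" for b
    using nn_integral_gauss_pair[of 0 \<gamma>2 b "\<theta> + \<gamma>1 * b"] \<gamma> by (simp add: config_kernel_def add_ac)
  have K3: "(\<integral>\<^sup>+a. (\<integral>\<^sup>+b. ?k a b c \<partial>lborel) \<partial>lborel) = 2 * pi / \<bar>\<gamma>1\<bar>" for c
    using nn_integral_gauss_pair[of 0 \<gamma>1 c "\<theta> + \<gamma>2 * c"] \<gamma> by (simp add: config_kernel_def add_ac)
  \<comment> \<open>Bounding the product by a sum of cubes separates the frequencies: each cube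
    depends on one of them, and the kernel is then integrated over the other two by
    \<open>K1\<close>, \<open>K2\<close>, \<open>K3\<close>.\<close>
  have pt: "ennreal (cmod (U a * (V b * W c) * ?k a b c)) \<le> u a * ?k a b c + v b * ?k a b c + w c * ?k a b c" for a b c
  proof -
    have "cmod (U a) * cmod (V b) * cmod (W c) = (p * q * r) * (cmod (U a) * cmod (V b) * cmod (W c))"
      using pqr by simp
    also have "\<dots> = (p * cmod (U a)) * (q * cmod (V b)) * (r * cmod (W c))" by (simp add: mult_ac)
    also have "\<dots> \<le> (p * cmod (U a)) ^ 3 + (q * cmod (V b)) ^ 3 + (r * cmod (W c)) ^ 3"
      using pqr by (intro mult3_le_sum_cubes) auto
    finally have "cmod (U a) * cmod (V b) * cmod (W c) * ?k a b c \<le>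
       (p ^ 3 * cmod (U a) ^ 3 + q ^ 3 * cmod (V b) ^ 3 + r ^ 3 * cmod (W c) ^ 3) * ?k a b c"
      by (intro mult_right_mono k0) (simp add: power_mult_distrib)
    hence "ennreal (cmod (U a * (V b * W c) * ?k a b c)) \<le>
       ennreal ((p ^ 3 * cmod (U a) ^ 3 + q ^ 3 * cmod (V b) ^ 3 + r ^ 3 * cmod (W c) ^ 3) * ?k a b c)"
      by (intro ennreal_leI) (simp add: norm_mult k0 mult_ac)
    also have "\<dots> = u a * ?k a b c + v b * ?k a b c + w c * ?k a b c"
      using pqr k0 by (simp add: u_def v_def w_def distrib_right ennreal_mult)
    finally show ?thesis .
  qed
  let ?I = "\<lambda>f. \<integral>\<^sup>+a. \<integral>\<^sup>+b. \<integral>\<^sup>+c. f a b c * ennreal (?k a b c) \<partial>lborel \<partial>lborel \<partial>lborel"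
  have T1: "?I (\<lambda>a b c. u a) = ennreal (2 * pi / \<bar>\<gamma>1 - \<gamma>2\<bar>) * (ennreal (p ^ 3) * cube_int U)"
  proof -
    have "?I (\<lambda>a b c. u a) = (\<integral>\<^sup>+a. u a * ennreal (2 * pi / \<bar>\<gamma>1 - \<gamma>2\<bar>) \<partial>lborel)"
      by (intro nn_integral_cong) (simp add: nn_integral_cmult K1)
    thus ?thesis using pqr by (simp add: nn_integral_multc u_def cube_int_def ennreal_mult nn_integral_cmult mult_ac)
  qed
  have T2: "?I (\<lambda>a b c. v b) = ennreal (2 * pi / \<bar>\<gamma>2\<bar>) * (ennreal (q ^ 3) * cube_int V)"
  proof -
    have "?I (\<lambda>a b c. v b) = (\<integral>\<^sup>+b. \<integral>\<^sup>+a. \<integral>\<^sup>+c. v b * ennreal (?k a b c) \<partial>lborel \<partial>lborel \<partial>lborel)"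
      by (rule lborel_pair.Fubini'[symmetric]) (simp add: nn_integral_cmult)
    also have "\<dots> = (\<integral>\<^sup>+b. v b * ennreal (2 * pi / \<bar>\<gamma>2\<bar>) \<partial>lborel)"
      by (intro nn_integral_cong) (simp add: nn_integral_cmult K2)
    finally show ?thesis using pqr by (simp add: nn_integral_multc v_def cube_int_def ennreal_mult nn_integral_cmult mult_ac)
  qed
  have T3: "?I (\<lambda>a b c. w c) = ennreal (2 * pi / \<bar>\<gamma>1\<bar>) * (ennreal (r ^ 3) * cube_int W)"
  proof -
    have "?I (\<lambda>a b c. w c) = (\<integral>\<^sup>+a. \<integral>\<^sup>+c. \<integral>\<^sup>+b. w c * ennreal (?k a b c) \<partial>lborel \<partial>lborel \<partial>lborel)"
      by (intro nn_integral_cong lborel_pair.Fubini'[symmetric]) simp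
    also have "\<dots> = (\<integral>\<^sup>+c. \<integral>\<^sup>+a. \<integral>\<^sup>+b. w c * ennreal (?k a b c) \<partial>lborel \<partial>lborel \<partial>lborel)"
      by (rule lborel_pair.Fubini'[symmetric]) (simp add: nn_integral_cmult)
    also have "\<dots> = (\<integral>\<^sup>+c. w c * ennreal (2 * pi / \<bar>\<gamma>1\<bar>) \<partial>lborel)"
      by (intro nn_integral_cong) (simp add: nn_integral_cmult K3)
    finally show ?thesis using pqr by (simp add: nn_integral_multc w_def cube_int_def ennreal_mult nn_integral_cmult mult_ac)
  qed
  let ?f = "\<lambda>a b c. U a * (V b * W c) * ?k a b c"
  have "ennreal (cmod (config_form \<gamma>1 \<gamma>2 \<theta> (inv_fourier U) (inv_fourier V) (inv_fourier W))) \<le>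
     (\<integral>\<^sup>+z. ennreal (cmod (?f (fst z) (fst (snd z)) (snd (snd z)))) \<partial>?L3)"
    unfolding config_form_inv_fourier(1)[OF U V W]
    by (intro integral_norm_bound_ennreal config_form_inv_fourier(2) U V W)
  also have "\<dots> = (\<integral>\<^sup>+a. \<integral>\<^sup>+b. \<integral>\<^sup>+c. ennreal (cmod (?f a b c)) \<partial>lborel \<partial>lborel \<partial>lborel)"
  proof (subst sigma_finite_measure.nn_integral_fst[OF sL2, symmetric])
    have "(\<integral>\<^sup>+y. ennreal (cmod (?f a (fst y) (snd y))) \<partial>?L2) =
        (\<integral>\<^sup>+b. \<integral>\<^sup>+c. ennreal (cmod (?f a b c)) \<partial>lborel \<partial>lborel)" for a
      by (subst lborel.nn_integral_fst[symmetric]) auto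
    thus "(\<integral>\<^sup>+a. \<integral>\<^sup>+y. ennreal (cmod (?f (fst (a, y)) (fst (snd (a, y))) (snd (snd (a, y))))) \<partial>?L2 \<partial>lborel) =
        (\<integral>\<^sup>+a. \<integral>\<^sup>+b. \<integral>\<^sup>+c. ennreal (cmod (?f a b c)) \<partial>lborel \<partial>lborel \<partial>lborel)"
      by simp
  qed measurable
  also have "\<dots> \<le> (\<integral>\<^sup>+a. \<integral>\<^sup>+b. \<integral>\<^sup>+c. u a * ?k a b c + v b * ?k a b c + w c * ?k a b c \<partial>lborel \<partial>lborel \<partial>lborel)"
    by (intro nn_integral_mono pt)
  also have "\<dots> = ?I (\<lambda>a b c. u a) + ?I (\<lambda>a b c. v b) + ?I (\<lambda>a b c. w c)"
    by (simp add: nn_integral_add)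
  also have "\<dots> \<le> ennreal (config_const \<gamma>1 \<gamma>2) * (ennreal (p ^ 3) * cube_int U)
     + ennreal (config_const \<gamma>1 \<gamma>2) * (ennreal (q ^ 3) * cube_int V)
     + ennreal (config_const \<gamma>1 \<gamma>2) * (ennreal (r ^ 3) * cube_int W)"
    unfolding T1 T2 T3 by (intro add_mono mult_right_mono ennreal_leI) (auto simp: config_const_def)
  finally show ?thesis by (simp add: distrib_left add_ac)
qed

subsection \<open>Gaussian mollification\<close>

definition mollify :: "real measure \<Rightarrow> real \<Rightarrow> real \<Rightarrow> real" where
  "mollify M \<sigma> x = (\<integral>y. normal_density y \<sigma> x \<partial>M)"

text \<open>The characteristic function of the mollified measure, divided by 2 pi to match
  \<open>inv_fourier\<close>.\<close>

definition mollify_hat :: "real measure \<Rightarrow> real \<Rightarrow> real \<Rightarrow> complex" where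
  "mollify_hat M \<sigma> a = complex_of_real (exp (- (\<sigma> * a)\<^sup>2 / 2) / (2 * pi)) * char M a"

lemma integrable_gauss_affine:
  fixes m q :: real
  assumes "m \<noteq> 0"
  shows "integrable lborel (\<lambda>x. exp (- (q + m * x)\<^sup>2 / 2))"
  by (rule integrableI_bounded) (use assms nn_integral_gauss_affine[of m q] in auto)

text \<open>The Gaussian is its own transform up to scaling: evaluate the characteristic function of
  the standard normal law at \<open>(y - x) / \<sigma>\<close> and rescale the integration variable
  by \<sigma>.\<close>

lemma normal_density_fourier:
  assumes "0 < \<sigma>"
  shows "complex_of_real (normal_density y \<sigma> x) =
    (CLINT a|lborel. complex_of_real (exp (- (\<sigma> * a)\<^sup>2 / 2) / (2 * pi)) * iexp (a * (y - x)))"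
proof -
  define t where "t = (y - x) / \<sigma>"
  have "complex_of_real (exp (- t\<^sup>2 / 2)) = char std_normal_distribution t"
    by (simp add: char_std_normal_distribution)
  also have "\<dots> = (CLINT x|lborel. std_normal_density x *\<^sub>R iexp (t * x))"
    unfolding char_def by (subst integral_density) auto
  also have "\<dots> = \<bar>\<sigma>\<bar> *\<^sub>R (CLINT a|lborel. std_normal_density (0 + \<sigma> * a) *\<^sub>R iexp (t * (0 + \<sigma> * a)))"
    using assms by (intro lborel_integral_real_affine) simp
  also have "\<dots> = \<bar>\<sigma>\<bar> *\<^sub>R (CLINT a|lborel. (2 * pi / sqrt (2 * pi)) *\<^sub>R
      (complex_of_real (exp (- (\<sigma> * a)\<^sup>2 / 2) / (2 * pi)) * iexp (a * (y - x))))"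
  proof -
    have "std_normal_density (0 + \<sigma> * a) *\<^sub>R iexp (t * (0 + \<sigma> * a)) = (2 * pi / sqrt (2 * pi)) *\<^sub>R
      (complex_of_real (exp (- (\<sigma> * a)\<^sup>2 / 2) / (2 * pi)) * iexp (a * (y - x)))" for a
      using assms by (simp add: std_normal_density_def t_def scaleR_conv_of_real mult_ac)
    thus ?thesis by simp
  qed
  also have "\<dots> = complex_of_real (\<sigma> * sqrt (2 * pi)) *
      (CLINT a|lborel. complex_of_real (exp (- (\<sigma> * a)\<^sup>2 / 2) / (2 * pi)) * iexp (a * (y - x)))"
    unfolding integral_scaleR_right using assms
    by (simp add: scaleR_conv_of_real real_div_sqrt mult.assoc)
  finally have *: "complex_of_real (exp (- t\<^sup>2 / 2)) = \<dots>" .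
  have "normal_density y \<sigma> x * (\<sigma> * sqrt (2 * pi)) = exp (- t\<^sup>2 / 2)"
    using assms
    by (simp add: normal_density_def t_def real_sqrt_mult power_divide power2_commute field_simps)
  hence "complex_of_real (normal_density y \<sigma> x) = complex_of_real (exp (- t\<^sup>2 / 2)) / complex_of_real (\<sigma> * sqrt (2 * pi))"
    using assms by (simp add: field_simps flip: of_real_mult)
  thus ?thesis unfolding * using assms by simp
qed

lemma (in real_distribution) borel_measurable_mollify_hat [measurable]: "mollify_hat M \<sigma> \<in> borel_measurable borel"
  unfolding mollify_hat_def by measurable

lemma (in real_distribution) integrable_mollify_hat:
  assumes "0 < \<sigma>"
  shows "integrable lborel (mollify_hat M \<sigma>)"
proof (rule Bochner_Integration.integrable_bound)
  show "integrable lborel (\<lambda>a. exp (- (0 + \<sigma> * a)\<^sup>2 / 2))"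
    using assms by (intro integrable_gauss_affine) simp
  have "cmod (mollify_hat M \<sigma> a) \<le> exp (- (\<sigma> * a)\<^sup>2 / 2) * 1" for a
  proof -
    have "cmod (mollify_hat M \<sigma> a) = (exp (- (\<sigma> * a)\<^sup>2 / 2) / (2 * pi)) * cmod (char M a)"
      unfolding mollify_hat_def norm_mult by (simp only: norm_of_real) simp
    also have "\<dots> \<le> exp (- (\<sigma> * a)\<^sup>2 / 2) * 1"
      using pi_ge_two by (intro mult_mono cmod_char_le_1) (auto simp: divide_le_eq)
    finally show ?thesis .
  qed
  thus "AE a in lborel. norm (mollify_hat M \<sigma> a) \<le> norm (exp (- (0 + \<sigma> * a)\<^sup>2 / 2))"
    by simp
qed simp

text \<open>No general inversion theorem enters. The previous formula holds for each Gaussian, and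
  Fubini integrates it over the centres \<open>y\<close>, since the Gaussian factor is integrable in
  \<open>a\<close> and \<open>M\<close> is finite.\<close>

lemma (in real_distribution) mollify_eq_inv_fourier:
  assumes "0 < \<sigma>"
  shows "complex_of_real (mollify M \<sigma> x) = inv_fourier (mollify_hat M \<sigma>) x"
proof -
  interpret PM: pair_sigma_finite M "lborel :: real measure" ..
  define G where "G a = exp (- (\<sigma> * a)\<^sup>2 / 2) / (2 * pi)" for a
  have G: "integrable lborel G"
    using integrable_gauss_affine[of \<sigma> 0] assms unfolding G_def by simp
  have [measurable]: "G \<in> borel_measurable borel" unfolding G_def by measurable
  define f where "f y a = complex_of_real (G a) * iexp (a * (y - x))" for y a
  have nf: "norm (f y a) = \<bar>G a\<bar>" for y a by (simp add: f_def norm_mult)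
  have int: "integrable (M \<Otimes>\<^sub>M lborel) (case_prod f)"
  proof (rule PM.Fubini_integrable)
    show "case_prod f \<in> borel_measurable (M \<Otimes>\<^sub>M lborel)" unfolding f_def by measurable
    show "AE y in M. integrable lborel (\<lambda>a. case (y, a) of (y, a) \<Rightarrow> f y a)"
    proof (intro AE_I2)
      fix y
      have "f y \<in> borel_measurable lborel" unfolding f_def by measurable
      thus "integrable lborel (\<lambda>a. case (y, a) of (y, a) \<Rightarrow> f y a)"
        by (intro Bochner_Integration.integrable_bound[OF G]) (auto simp: nf)
    qed
  qed (simp add: nf)
  have "complex_of_real (mollify M \<sigma> x) = (CLINT y|M. complex_of_real (normal_density y \<sigma> x))"
    unfolding mollify_def by simp
  also have "\<dots> = (CLINT y|M. CLINT a|lborel. f y a)"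
    unfolding normal_density_fourier[OF assms] f_def G_def ..
  also have "\<dots> = (CLINT a|lborel. CLINT y|M. f y a)"
    by (rule PM.Fubini_integral[symmetric, OF int])
  also have "\<dots> = (CLINT a|lborel. mollify_hat M \<sigma> a * iexp (- (a * x)))"
  proof (rule Bochner_Integration.integral_cong[OF refl])
    fix a
    have "(CLINT y|M. f y a) = (CLINT y|M. (G a * iexp (- (a * x))) * iexp (a * y))"
      by (intro Bochner_Integration.integral_cong refl)
         (simp add: f_def exp_add[symmetric] algebra_simps mult_exp_exp)
    also have "\<dots> = (G a * iexp (- (a * x))) * char M a"
      unfolding char_def by simp
    finally show "(CLINT y|M. f y a) = mollify_hat M \<sigma> a * iexp (- (a * x))"
      unfolding mollify_hat_def G_def by (simp only: mult_ac)
  qed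
  finally show ?thesis unfolding inv_fourier_def .
qed

lemma (in real_distribution) cube_int_mollify_hat: "cube_int (mollify_hat M \<sigma>) \<le> cube_int (char M)"
  unfolding cube_int_def
proof (intro nn_integral_mono ennreal_leI power_mono)
  fix a
  have "cmod (mollify_hat M \<sigma> a) = (exp (- (\<sigma> * a)\<^sup>2 / 2) / (2 * pi)) * cmod (char M a)"
    unfolding mollify_hat_def norm_mult by (simp only: norm_of_real) simp
  also have "\<dots> \<le> 1 * cmod (char M a)"
  proof (intro mult_right_mono)
    have "exp (- (\<sigma> * a)\<^sup>2 / 2) \<le> 1" by simp
    thus "exp (- (\<sigma> * a)\<^sup>2 / 2) / (2 * pi) \<le> 1" 
      using pi_ge_two order_trans[of "exp (- (\<sigma> * a)\<^sup>2 / 2)" 1 "2 * pi"] by (simp add: divide_le_eq)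
  qed simp
  finally show "cmod (mollify_hat M \<sigma> a) \<le> cmod (char M a)" by simp
qed simp

text \<open>Both exponentials lie between \<open>exp (- (\<sigma>0 * a)\<^sup>2 / 2)\<close> and 1,
  so their difference is at most 1 and at most \<open>(\<sigma>0 * a)\<^sup>2 / 2\<close>. Because
  \<kappa> is at most 1, these two bounds give the power \<kappa> on either side of
  \<open>\<sigma>0 * \<bar>a\<bar> = 1\<close>; the cube is discarded.\<close>

lemma gauss_diff_cube_le:
  fixes \<sigma> \<sigma>' \<sigma>0 \<kappa> a :: real
  assumes "0 < \<sigma>" "\<sigma> \<le> \<sigma>0" "0 < \<sigma>'" "\<sigma>' \<le> \<sigma>0" "0 < \<kappa>" "\<kappa> \<le> 1"
  shows "\<bar>exp (- (\<sigma> * a)\<^sup>2 / 2) - exp (- (\<sigma>' * a)\<^sup>2 / 2)\<bar> ^ 3 \<le> (\<sigma>0 * \<bar>a\<bar>) powr \<kappa>"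
proof (cases "a = 0")
  case False
  define d where "d = \<bar>exp (- (\<sigma> * a)\<^sup>2 / 2) - exp (- (\<sigma>' * a)\<^sup>2 / 2)\<bar>"
  have low: "exp (- (\<sigma>0 * a)\<^sup>2 / 2) \<le> exp (- (r * a)\<^sup>2 / 2)" if "0 < r" "r \<le> \<sigma>0" for r
    using that by (auto simp: power_mult_distrib intro!: mult_right_mono power_mono)
  have up: "exp (- (r * a)\<^sup>2 / 2) \<le> 1" for r by simp
  have d0: "0 \<le> d" and d1: "d \<le> 1 - exp (- (\<sigma>0 * a)\<^sup>2 / 2)"
    using low[of \<sigma>] low[of \<sigma>'] up[of \<sigma>] up[of \<sigma>'] assms unfolding d_def by linarith+
  have d2: "d \<le> 1" using d1 exp_ge_zero[of "- (\<sigma>0 * a)\<^sup>2 / 2"] by linarith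
  have "d ^ 3 \<le> d" using power_decreasing[of 1 3 d] d0 d2 by simp
  also have "d \<le> (\<sigma>0 * \<bar>a\<bar>) powr \<kappa>"
  proof (cases "\<sigma>0 * \<bar>a\<bar> \<le> 1")
    case True
    have pos: "0 < \<sigma>0 * \<bar>a\<bar>" using assms False by simp
    have "d \<le> (\<sigma>0 * \<bar>a\<bar>)\<^sup>2 / 2"
      using d1 exp_ge_add_one_self[of "- (\<sigma>0 * a)\<^sup>2 / 2"] by (simp add: power_mult_distrib)
    also have "\<dots> \<le> (\<sigma>0 * \<bar>a\<bar>) ^ 1"
      using power_decreasing[of 1 2 "\<sigma>0 * \<bar>a\<bar>"] pos True by simp
    also have "\<dots> = (\<sigma>0 * \<bar>a\<bar>) powr 1" using pos by simp
    also have "\<dots> \<le> (\<sigma>0 * \<bar>a\<bar>) powr \<kappa>"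
      using True pos assms by (intro powr_mono') auto
    finally show ?thesis .
  next
    case False
    hence "1 \<le> (\<sigma>0 * \<bar>a\<bar>) powr \<kappa>" using assms by (intro ge_one_powr_ge_zero) auto
    thus ?thesis using d2 by linarith
  qed
  finally show ?thesis unfolding d_def .
qed simp

text \<open>A positive power of the scale is gained in exchange for the weight
  \<open>\<bar>a\<bar> powr \<kappa>\<close>. The gain is the same for all measures whose weighted
  cubic integral has a common bound.\<close>

lemma (in real_distribution) cube_int_mollify_hat_diff:
  assumes "0 < \<sigma>" "\<sigma> \<le> \<sigma>0" "0 < \<sigma>'" "\<sigma>' \<le> \<sigma>0" "0 < \<kappa>" "\<kappa> \<le> 1"
  shows "cube_int (\<lambda>a. mollify_hat M \<sigma> a - mollify_hat M \<sigma>' a) \<le>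
    ennreal (\<sigma>0 powr \<kappa>) * (\<integral>\<^sup>+a. ennreal (cmod (char M a) ^ 3 * \<bar>a\<bar> powr \<kappa>) \<partial>lborel)"
proof -
  have "cmod (mollify_hat M \<sigma> a - mollify_hat M \<sigma>' a) ^ 3 \<le> \<sigma>0 powr \<kappa> * (cmod (char M a) ^ 3 * \<bar>a\<bar> powr \<kappa>)" for a
  proof -
    let ?d = "\<bar>exp (- (\<sigma> * a)\<^sup>2 / 2) - exp (- (\<sigma>' * a)\<^sup>2 / 2)\<bar>"
    have "mollify_hat M \<sigma> a - mollify_hat M \<sigma>' a =
       complex_of_real ((exp (- (\<sigma> * a)\<^sup>2 / 2) - exp (- (\<sigma>' * a)\<^sup>2 / 2)) / (2 * pi)) * char M a"
      by (simp add: mollify_hat_def algebra_simps diff_divide_distrib)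
    hence "cmod (mollify_hat M \<sigma> a - mollify_hat M \<sigma>' a) = ?d / (2 * pi) * cmod (char M a)"
      by (simp only: norm_mult norm_of_real abs_divide) simp
    also have "\<dots> \<le> ?d * cmod (char M a)"
      using pi_ge_two by (intro mult_right_mono) (auto simp: divide_le_eq mult_le_cancel_left1)
    finally have "cmod (mollify_hat M \<sigma> a - mollify_hat M \<sigma>' a) ^ 3 \<le> (?d * cmod (char M a)) ^ 3"
      by (intro power_mono) auto
    also have "\<dots> = ?d ^ 3 * cmod (char M a) ^ 3" by (simp add: power_mult_distrib)
    also have "\<dots> \<le> (\<sigma>0 * \<bar>a\<bar>) powr \<kappa> * cmod (char M a) ^ 3"
      by (intro mult_right_mono gauss_diff_cube_le assms) simp
    finally show ?thesis using assms by (simp add: powr_mult mult_ac)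
  qed
  hence "cube_int (\<lambda>a. mollify_hat M \<sigma> a - mollify_hat M \<sigma>' a) \<le>
     (\<integral>\<^sup>+a. ennreal (\<sigma>0 powr \<kappa> * (cmod (char M a) ^ 3 * \<bar>a\<bar> powr \<kappa>)) \<partial>lborel)"
    unfolding cube_int_def by (intro nn_integral_mono ennreal_leI)
  also have "\<dots> = ennreal (\<sigma>0 powr \<kappa>) * (\<integral>\<^sup>+a. ennreal (cmod (char M a) ^ 3 * \<bar>a\<bar> powr \<kappa>) \<partial>lborel)"
    by (simp add: ennreal_mult nn_integral_cmult)
  finally show ?thesis .
qed

section \<open>Stability of the form under a change of scale\<close>

lemma prob_space_gauss_plane: "prob_space gauss_plane"
  by (intro prob_space_pair prob_space_normal_density) auto

lemma sets_gauss_plane [measurable_cong]: "sets gauss_plane = sets (borel \<Otimes>\<^sub>M borel)"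
  by (intro sets_pair_measure_cong) auto

lemma integrable_iexp_times:
  assumes "integrable lborel U"
  shows "integrable lborel (\<lambda>a. U a * iexp (- (a * x)))"
proof -
  note [measurable] = borel_measurable_integrable[OF assms]
  show ?thesis by (rule Bochner_Integration.integrable_bound[OF assms]) (auto simp: norm_mult)
qed

lemma inv_fourier_diff:
  assumes "integrable lborel U" "integrable lborel V"
  shows "inv_fourier (\<lambda>a. U a - V a) x = inv_fourier U x - inv_fourier V x"
  unfolding inv_fourier_def left_diff_distrib
  by (intro Bochner_Integration.integral_diff integrable_iexp_times assms)

lemma norm_inv_fourier_le: "norm (inv_fourier U x) \<le> (\<integral>a. norm (U a) \<partial>lborel)"
  unfolding inv_fourier_def using integral_norm_bound[of lborel "\<lambda>a. U a * iexp (- (a * x))"]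
  by (simp add: norm_mult)

lemma integrable_config:
  fixes u v w :: "real \<Rightarrow> complex"
  assumes [measurable]: "u \<in> borel_measurable borel" "v \<in> borel_measurable borel" "w \<in> borel_measurable borel"
    and b: "\<And>x. cmod (u x) \<le> A" "\<And>x. cmod (v x) \<le> B" "\<And>x. cmod (w x) \<le> C"
  shows "integrable gauss_plane (\<lambda>z. iexp (\<theta> * snd z) *
        (u (fst z) * v (fst z - \<gamma>1 * snd z) * w (fst z - \<gamma>2 * snd z)))"
proof -
  interpret prob_space gauss_plane by (rule prob_space_gauss_plane)
  have pos: "0 \<le> A" "0 \<le> B" using b order_trans[OF norm_ge_zero] by blast+
  show ?thesis
  proof (rule integrable_const_bound[where B="A * B * C"])
    show "AE z in gauss_plane. norm (iexp (\<theta> * snd z) *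
        (u (fst z) * v (fst z - \<gamma>1 * snd z) * w (fst z - \<gamma>2 * snd z))) \<le> A * B * C"
      unfolding norm_mult using b pos by (auto intro!: mult_mono mult_nonneg_nonneg AE_I2)
  qed measurable
qed

lemma config_form_telescope:
  fixes \<gamma>1 \<gamma>2 \<theta> :: real
  assumes U: "integrable lborel U" and V: "integrable lborel V"
  defines "D \<equiv> \<lambda>a. U a - V a" and "T \<equiv> config_form \<gamma>1 \<gamma>2 \<theta>"
  shows "T (inv_fourier U) (inv_fourier U) (inv_fourier U) - T (inv_fourier V) (inv_fourier V) (inv_fourier V) =
    T (inv_fourier D) (inv_fourier U) (inv_fourier U) + T (inv_fourier V) (inv_fourier D) (inv_fourier U)
      + T (inv_fourier V) (inv_fourier V) (inv_fourier D)"
proof -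
  note [measurable] = borel_measurable_integrable[OF U] borel_measurable_integrable[OF V]
  have [measurable]: "D \<in> borel_measurable borel" unfolding D_def by measurable
  have D: "inv_fourier D x = inv_fourier U x - inv_fourier V x" for x
    unfolding D_def by (rule inv_fourier_diff[OF U V])
  define I where "I X Y Z z = iexp (\<theta> * snd z) * (inv_fourier X (fst z) * inv_fourier Y (fst z - \<gamma>1 * snd z) *
     inv_fourier Z (fst z - \<gamma>2 * snd z))" for X Y Z :: "real \<Rightarrow> complex" and z
  have i: "integrable gauss_plane (I X Y Z)"
    if "X \<in> borel_measurable borel" "Y \<in> borel_measurable borel" "Z \<in> borel_measurable borel" for X Y Z
    unfolding I_def by (rule integrable_config) (use that norm_inv_fourier_le in auto)
  have i': "integrable gauss_plane (I U U U)" "integrable gauss_plane (I V V V)" "integrable gauss_plane (I D U U)"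
      "integrable gauss_plane (I V D U)" "integrable gauss_plane (I V V D)"
    by (rule i; simp)+
  have T: "T (inv_fourier X) (inv_fourier Y) (inv_fourier Z) = (\<integral>z. I X Y Z z \<partial>gauss_plane)" for X Y Z
    unfolding T_def config_form_def I_def ..
  have "I U U U z - I V V V z = I D U U z + I V D U z + I V V D z" for z
    by (simp add: I_def D algebra_simps)
  hence "(\<integral>z. I U U U z - I V V V z \<partial>gauss_plane) = (\<integral>z. I D U U z + I V D U z + I V V D z \<partial>gauss_plane)"
    by simp
  thus ?thesis unfolding T using i' by simp
qed

text \<open>In each telescoped term the slot holding the difference \<open>D\<close> receives the
  weight \<open>k\<^sup>2\<close> and the other two receive \<open>1 / k\<close>. Cubed, this costs
  a factor \<open>k ^ 6\<close> on the small integral and gains \<open>1 / k ^ 3\<close> on the two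
  merely bounded ones. The parameter \<open>k\<close> stays free until the accuracy is
  known.\<close>

lemma (in real_distribution) config_form_mollify_diff:
  fixes \<gamma>1 \<gamma>2 \<theta> :: real
  assumes \<gamma>: "\<gamma>1 \<noteq> 0" "\<gamma>2 \<noteq> 0" "\<gamma>1 \<noteq> \<gamma>2" and \<kappa>: "0 < \<kappa>" "\<kappa> \<le> 1" and B: "0 \<le> B"
    and cube: "cube_int (char M) \<le> ennreal B"
    and wcube: "(\<integral>\<^sup>+a. ennreal (cmod (char M a) ^ 3 * \<bar>a\<bar> powr \<kappa>) \<partial>lborel) \<le> ennreal B"
    and \<sigma>: "0 < \<sigma>" "\<sigma> \<le> \<sigma>0" "0 < \<sigma>'" "\<sigma>' \<le> \<sigma>0" and k: "0 < k"
  defines "T \<equiv> \<lambda>\<sigma>. config_form \<gamma>1 \<gamma>2 \<theta> (\<lambda>x. mollify M \<sigma> x) (\<lambda>x. mollify M \<sigma> x) (\<lambda>x. mollify M \<sigma> x)"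
  shows "cmod (T \<sigma> - T \<sigma>') \<le> 3 * config_const \<gamma>1 \<gamma>2 * B * (k ^ 6 * \<sigma>0 powr \<kappa> + 2 / k ^ 3)"
proof -
  define U V where "U = mollify_hat M \<sigma>" and "V = mollify_hat M \<sigma>'"
  define D where "D = (\<lambda>a. U a - V a)"
  have U: "integrable lborel U" and V: "integrable lborel V"
    unfolding U_def V_def using \<sigma> by (auto intro: integrable_mollify_hat)
  hence D: "integrable lborel D" unfolding D_def by auto
  have cU: "cube_int U \<le> ennreal B" and cV: "cube_int V \<le> ennreal B"
    unfolding U_def V_def using cube_int_mollify_hat cube order_trans by blast+
  have "cube_int D \<le> ennreal (\<sigma>0 powr \<kappa>) * (\<integral>\<^sup>+a. ennreal (cmod (char M a) ^ 3 * \<bar>a\<bar> powr \<kappa>) \<partial>lborel)"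
    unfolding D_def U_def V_def by (intro cube_int_mollify_hat_diff \<sigma> \<kappa>)
  also have "\<dots> \<le> ennreal (\<sigma>0 powr \<kappa>) * ennreal B" by (intro mult_left_mono wcube) simp
  finally have cD: "cube_int D \<le> ennreal (\<sigma>0 powr \<kappa> * B)" by (simp add: ennreal_mult')
  let ?C = "config_const \<gamma>1 \<gamma>2"
  let ?E = "?C * B * (k ^ 6 * \<sigma>0 powr \<kappa> + 2 / k ^ 3)"
  let ?F = "\<lambda>X Y Z. config_form \<gamma>1 \<gamma>2 \<theta> (inv_fourier X) (inv_fourier Y) (inv_fourier Z)"
  have step: "cmod (?F X Y Z) \<le> ?C * (p ^ 3 * x + q ^ 3 * y + r ^ 3 * z)"
    if "integrable lborel X" "integrable lborel Y" "integrable lborel Z"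
      and xyz: "cube_int X \<le> ennreal x" "cube_int Y \<le> ennreal y" "cube_int Z \<le> ennreal z"
      and nn: "0 \<le> x" "0 \<le> y" "0 \<le> z" and pqr: "0 < p" "0 < q" "0 < r" "p * q * r = 1"
    for X Y Z x y z p q r
  proof -
    have "ennreal (cmod (?F X Y Z)) \<le> ennreal ?C *
      (ennreal (p ^ 3) * cube_int X + ennreal (q ^ 3) * cube_int Y + ennreal (r ^ 3) * cube_int Z)"
      by (intro config_form_bound that \<gamma>)
    also have "\<dots> \<le> ennreal ?C *
      (ennreal (p ^ 3) * ennreal x + ennreal (q ^ 3) * ennreal y + ennreal (r ^ 3) * ennreal z)"
      by (intro mult_left_mono add_mono xyz) auto
    also have "\<dots> = ennreal (?C * (p ^ 3 * x + q ^ 3 * y + r ^ 3 * z))"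
      using nn pqr config_const_nonneg by (simp add: ennreal_mult' ennreal_plus)
    finally show ?thesis
      using nn pqr config_const_nonneg[of \<gamma>1 \<gamma>2] by (subst (asm) ennreal_le_iff) auto
  qed
  have s0: "0 \<le> \<sigma>0 powr \<kappa> * B" using B by simp
  have pw: "(k\<^sup>2) ^ 3 = k ^ 6" "(1 / k) ^ 3 = 1 / k ^ 3" by (simp_all add: power_divide flip: power_mult)
  have pq: "0 < k\<^sup>2" "0 < 1 / k" "k\<^sup>2 * (1 / k) * (1 / k) = 1" "(1 / k) * k\<^sup>2 * (1 / k) = 1"
      "(1 / k) * (1 / k) * k\<^sup>2 = 1"
    using k by (auto simp: power2_eq_square)
  have 1: "cmod (?F D U U) \<le> ?E"
    using step[OF D U U cD cU cU s0 B B pq(1,2,2,3)] unfolding pw by (simp add: algebra_simps)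
  have 2: "cmod (?F V D U) \<le> ?E"
    using step[OF V D U cV cD cU B s0 B pq(2,1,2,4)] unfolding pw by (simp add: algebra_simps)
  have 3: "cmod (?F V V D) \<le> ?E"
    using step[OF V V D cV cV cD B B s0 pq(2,2,1,5)] unfolding pw by (simp add: algebra_simps)
  have "T \<sigma> - T \<sigma>' = ?F U U U - ?F V V V"
    unfolding T_def U_def V_def using mollify_eq_inv_fourier[OF \<sigma>(1)] mollify_eq_inv_fourier[OF \<sigma>(3)] by simp
  also have "\<dots> = ?F D U U + ?F V D U + ?F V V D"
    unfolding D_def by (rule config_form_telescope[OF U V])
  finally have "cmod (T \<sigma> - T \<sigma>') \<le> cmod (?F D U U) + cmod (?F V D U) + cmod (?F V V D)"
    by (simp add: order_trans[OF norm_triangle_ineq add_mono[OF norm_triangle_ineq order_refl]])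
  also have "\<dots> \<le> ?E + ?E + ?E" by (intro add_mono 1 2 3)
  also have "\<dots> = 3 * ?E" by simp
  finally show ?thesis by (simp only: mult.assoc)
qed

text \<open>Here all three weights are 1. At \<theta> = 0 this bounds the count taken without the
  factor \<open>1 - cos t\<close>, uniformly in the scale.\<close>

lemma (in real_distribution) config_form_mollify_bound:
  assumes \<gamma>: "\<gamma>1 \<noteq> 0" "\<gamma>2 \<noteq> 0" "\<gamma>1 \<noteq> \<gamma>2" and B: "0 \<le> B"
    and cube: "cube_int (char M) \<le> ennreal B" and \<sigma>: "0 < \<sigma>"
  shows "cmod (config_form \<gamma>1 \<gamma>2 \<theta> (\<lambda>x. mollify M \<sigma> x) (\<lambda>x. mollify M \<sigma> x) (\<lambda>x. mollify M \<sigma> x))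
    \<le> 3 * config_const \<gamma>1 \<gamma>2 * B"
proof -
  define U where "U = mollify_hat M \<sigma>"
  have U: "integrable lborel U" unfolding U_def using \<sigma> by (rule integrable_mollify_hat)
  have cU: "cube_int U \<le> ennreal B" unfolding U_def using cube_int_mollify_hat cube order_trans by blast
  have "ennreal (cmod (config_form \<gamma>1 \<gamma>2 \<theta> (inv_fourier U) (inv_fourier U) (inv_fourier U))) \<le>
     ennreal (config_const \<gamma>1 \<gamma>2) *
      (ennreal (1 ^ 3) * cube_int U + ennreal (1 ^ 3) * cube_int U + ennreal (1 ^ 3) * cube_int U)"
    by (intro config_form_bound \<gamma> U) auto
  also have "\<dots> \<le> ennreal (config_const \<gamma>1 \<gamma>2) * (ennreal B + ennreal B + ennreal B)"
    by (intro mult_left_mono add_mono) (use cU in auto)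
  also have "\<dots> = ennreal (config_const \<gamma>1 \<gamma>2 * (B + B + B))"
  proof -
    have "ennreal B + ennreal B + ennreal B = ennreal (B + B + B)"
      using B by (simp only: ennreal_plus add_nonneg_nonneg)
    thus ?thesis by (simp only: ennreal_mult'[OF config_const_nonneg])
  qed
  finally have "cmod (config_form \<gamma>1 \<gamma>2 \<theta> (inv_fourier U) (inv_fourier U) (inv_fourier U)) \<le>
      config_const \<gamma>1 \<gamma>2 * (B + B + B)"
    using B config_const_nonneg[of \<gamma>1 \<gamma>2] by (subst (asm) ennreal_le_iff) auto
  moreover have "(\<lambda>x. complex_of_real (mollify M \<sigma> x)) = inv_fourier U"
    unfolding U_def using mollify_eq_inv_fourier[OF \<sigma>] by auto
  ultimately show ?thesis by simp
qed

text \<open>The order of choice matters: \<open>k\<close> first, to make the term with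
  \<open>1 / k ^ 3\<close> small, and then \<sigma>0 small enough to absorb
  \<open>k ^ 6\<close>.\<close>

lemma uniform_cauchy_parameter:
  fixes L \<kappa> e :: real
  assumes "0 \<le> L" "0 < \<kappa>" "0 < e"
  obtains \<sigma>0 k where "0 < \<sigma>0" "0 < k" "L * (k ^ 6 * \<sigma>0 powr \<kappa> + 2 / k ^ 3) \<le> e"
proof -
  \<comment> \<open>\<open>4 * L / e\<close> brings \<open>2 * L / k\<close> down to
    \<open>e / 2\<close>, and \<open>1 \<le> k\<close> allows \<open>k ^ 3\<close> to be replaced by
    \<open>k\<close>.\<close>
  define k where "k = max 1 (4 * L / e)"
  \<comment> \<open>The solution of
    \<open>k ^ 6 * \<sigma>0 powr \<kappa> = e / (2 * (L + 1))\<close>; adding 1 to \<open>L\<close>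
    avoids a zero denominator.\<close>
  define \<sigma>0 where "\<sigma>0 = (e / (2 * (L + 1) * k ^ 6)) powr (1 / \<kappa>)"
  have k: "1 \<le> k" "4 * L / e \<le> k" by (auto simp: k_def)
  have s: "\<sigma>0 powr \<kappa> = e / (2 * (L + 1) * k ^ 6)" unfolding \<sigma>0_def powr_powr using assms k by simp
  have "L * (k ^ 6 * \<sigma>0 powr \<kappa>) = (e / 2) * (L / (L + 1))"
  proof -
    have "k ^ 6 * (e / (2 * (L + 1) * k ^ 6)) = e / (2 * (L + 1))" using k by simp
    hence "L * (k ^ 6 * \<sigma>0 powr \<kappa>) = L * (e / (2 * (L + 1)))" unfolding s by (simp only:)
    thus ?thesis by simp
  qed
  also have "\<dots> \<le> (e / 2) * 1" using assms by (intro mult_left_mono) auto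
  finally have 1: "L * (k ^ 6 * \<sigma>0 powr \<kappa>) \<le> e / 2" by simp
  have "L * (2 / k ^ 3) \<le> L * (2 / k)"
    using k assms by (intro mult_left_mono divide_left_mono) (auto intro: self_le_power)
  also have "\<dots> \<le> e / 2" using k assms by (simp add: field_simps)
  finally have "L * (k ^ 6 * \<sigma>0 powr \<kappa> + 2 / k ^ 3) \<le> e" using 1 by (simp add: distrib_left)
  moreover have "0 < \<sigma>0" unfolding \<sigma>0_def using assms k by simp
  ultimately show ?thesis using k that[of \<sigma>0 k] by auto
qed

subsection \<open>Counting configurations\<close>

text \<open>The factor \<open>1 - cos t\<close> is nonnegative, vanishes at \<open>t = 0\<close>,
  and is the real part of \<open>1 - iexp t\<close>. Hence the count is a difference of two values
  of \<open>config_form\<close>, and every estimate for the form transfers to it.\<close>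

definition config_mass :: "real \<Rightarrow> real \<Rightarrow> real measure \<Rightarrow> real \<Rightarrow> real" where
  "config_mass \<gamma>1 \<gamma>2 M \<sigma> = (\<integral>z. (1 - cos (snd z)) *
     (mollify M \<sigma> (fst z) * mollify M \<sigma> (fst z - \<gamma>1 * snd z) * mollify M \<sigma> (fst z - \<gamma>2 * snd z)) \<partial>gauss_plane)"

text \<open>The normalising factor \<open>1 / sqrt (2 * pi)\<close> is dropped. The case \<eta> = 0
  is the uniform bound by \<open>1 / \<sigma>\<close>.\<close>

lemma normal_density_le:
  assumes "0 < \<sigma>" "0 \<le> \<eta>" "\<eta> \<le> \<bar>x - y\<bar>"
  shows "normal_density y \<sigma> x \<le> exp (- \<eta>\<^sup>2 / (2 * \<sigma>\<^sup>2)) / \<sigma>"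
proof -
  have "1 \<le> sqrt (2 * pi)" using pi_ge_two by simp
  hence "\<sigma> \<le> sqrt (2 * pi * \<sigma>\<^sup>2)" using assms by (simp add: real_sqrt_mult)
  moreover have "\<eta>\<^sup>2 \<le> (x - y)\<^sup>2" using assms by (metis abs_le_square_iff abs_of_nonneg)
  ultimately have "1 / sqrt (2 * pi * \<sigma>\<^sup>2) * exp (- (x - y)\<^sup>2 / (2 * \<sigma>\<^sup>2)) \<le> 1 / \<sigma> * exp (- \<eta>\<^sup>2 / (2 * \<sigma>\<^sup>2))"
    using assms by (intro mult_mono divide_left_mono) (auto simp: divide_le_cancel)
  thus ?thesis by (simp add: normal_density_def)
qed

context real_distribution
begin

lemma borel_measurable_mollify [measurable]: "mollify M \<sigma> \<in> borel_measurable borel"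
  unfolding mollify_def[abs_def] normal_density_def by measurable

lemma integrable_normal_density_shift:
  assumes "0 < \<sigma>"
  shows "integrable M (\<lambda>y. normal_density y \<sigma> x)"
proof (rule integrable_const_bound[where B="1 / \<sigma>"])
  show "AE y in M. norm (normal_density y \<sigma> x) \<le> 1 / \<sigma>"
    using normal_density_le[OF assms, of 0] by (auto simp: normal_density_nonneg)
qed (simp add: normal_density_def)

lemma mollify_nonneg: "0 \<le> mollify M \<sigma> x"
  unfolding mollify_def by (intro Bochner_Integration.integral_nonneg normal_density_nonneg)

lemma mollify_le_far:
  assumes "0 < \<sigma>" "0 \<le> \<eta>" "AE y in M. \<eta> \<le> \<bar>x - y\<bar>"
  shows "mollify M \<sigma> x \<le> exp (- \<eta>\<^sup>2 / (2 * \<sigma>\<^sup>2)) / \<sigma>"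
  unfolding mollify_def
proof (intro integral_le_const integrable_normal_density_shift assms(1))
  show "AE y in M. normal_density y \<sigma> x \<le> exp (- \<eta>\<^sup>2 / (2 * \<sigma>\<^sup>2)) / \<sigma>"
    using assms(3) by eventually_elim (rule normal_density_le[OF assms(1,2)])
qed

lemma mollify_le: "0 < \<sigma> \<Longrightarrow> mollify M \<sigma> x \<le> 1 / \<sigma>"
  using mollify_le_far[of \<sigma> 0 x] by simp

lemma integrable_config_mollify:
  assumes "0 < \<sigma>" and [measurable]: "g \<in> borel_measurable borel" and g: "\<And>t. \<bar>g t\<bar> \<le> B"
  shows "integrable gauss_plane (\<lambda>z. g (snd z) *
     (mollify M \<sigma> (fst z) * mollify M \<sigma> (fst z - \<gamma>1 * snd z) * mollify M \<sigma> (fst z - \<gamma>2 * snd z)))"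
proof -
  interpret G: prob_space gauss_plane by (rule prob_space_gauss_plane)
  have "0 \<le> B" using g[of 0] by linarith
  show ?thesis
  proof (rule G.integrable_const_bound[where B="B * (1 / \<sigma> * (1 / \<sigma>) * (1 / \<sigma>))"])
    show "AE z in gauss_plane. norm (g (snd z) *
      (mollify M \<sigma> (fst z) * mollify M \<sigma> (fst z - \<gamma>1 * snd z) * mollify M \<sigma> (fst z - \<gamma>2 * snd z)))
      \<le> B * (1 / \<sigma> * (1 / \<sigma>) * (1 / \<sigma>))"
      unfolding real_norm_def abs_mult abs_of_nonneg[OF mollify_nonneg]
      by (intro AE_I2 mult_mono g mollify_le mollify_nonneg mult_nonneg_nonneg assms) (use assms \<open>0 \<le> B\<close> in auto)
  qed measurable
qed

lemma Re_config_form_mollify: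
  assumes "0 < \<sigma>"
  shows "Re (config_form \<gamma>1 \<gamma>2 \<theta> (\<lambda>x. mollify M \<sigma> x) (\<lambda>x. mollify M \<sigma> x) (\<lambda>x. mollify M \<sigma> x)) =
    (\<integral>z. cos (\<theta> * snd z) *
     (mollify M \<sigma> (fst z) * mollify M \<sigma> (fst z - \<gamma>1 * snd z) * mollify M \<sigma> (fst z - \<gamma>2 * snd z)) \<partial>gauss_plane)"
proof -
  have "integrable gauss_plane (\<lambda>z. iexp (\<theta> * snd z) * (complex_of_real (mollify M \<sigma> (fst z)) *
     complex_of_real (mollify M \<sigma> (fst z - \<gamma>1 * snd z)) * complex_of_real (mollify M \<sigma> (fst z - \<gamma>2 * snd z))))"
    by (rule integrable_config[where A="1 / \<sigma>" and B="1 / \<sigma>" and C="1 / \<sigma>"])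
       (use mollify_nonneg mollify_le assms in auto)
  from integral_Re[OF this] show ?thesis
    unfolding config_form_def
    by (auto simp: Re_exp intro!: Bochner_Integration.integral_cong)
qed

lemma config_mass_eq_config_form:
  fixes \<gamma>1 \<gamma>2 \<sigma> :: real
  assumes "0 < \<sigma>"
  defines "T \<equiv> \<lambda>\<theta>. config_form \<gamma>1 \<gamma>2 \<theta> (\<lambda>x. mollify M \<sigma> x) (\<lambda>x. mollify M \<sigma> x) (\<lambda>x. mollify M \<sigma> x)"
  shows "config_mass \<gamma>1 \<gamma>2 M \<sigma> = Re (T 0) - Re (T 1)"
proof -
  let ?m = "\<lambda>z. mollify M \<sigma> (fst z) * mollify M \<sigma> (fst z - \<gamma>1 * snd z) * mollify M \<sigma> (fst z - \<gamma>2 * snd z)"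
  have i: "integrable gauss_plane (\<lambda>z. 1 * ?m z)" "integrable gauss_plane (\<lambda>z. cos (snd z) * ?m z)"
    using assms integrable_config_mollify[of \<sigma> "\<lambda>_. 1" 1] integrable_config_mollify[of \<sigma> cos 1] by auto
  have "config_mass \<gamma>1 \<gamma>2 M \<sigma> = (\<integral>z. 1 * ?m z - cos (snd z) * ?m z \<partial>gauss_plane)"
    unfolding config_mass_def by (simp add: left_diff_distrib)
  also have "\<dots> = (\<integral>z. 1 * ?m z \<partial>gauss_plane) - (\<integral>z. cos (snd z) * ?m z \<partial>gauss_plane)"
    by (rule Bochner_Integration.integral_diff[OF i])
  finally show ?thesis unfolding T_def Re_config_form_mollify[OF assms(1)] by simp
qed

text \<open>Each point outside the support has a null open neighbourhood. There may be uncountably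
  many of these, but the line is Lindelof, so countably many have the same union and it is
  null.\<close>

lemma AE_in_closed_support:
  assumes "measure_support M \<subseteq> A"
  shows "AE x in M. x \<in> A"
proof -
  define F where "F = {U. open U \<and> emeasure M U = 0}"
  obtain F' where F': "F' \<subseteq> F" "countable F'" "\<Union>F' = \<Union>F"
    using Lindelof[of F] unfolding F_def by auto
  have "\<Union>F' \<in> null_sets M"
    using F' by (intro null_sets_UN'[of F' id, simplified]) (auto simp: F_def null_sets_def)
  moreover have "- A \<subseteq> \<Union>F"
  proof
    fix x assume "x \<in> - A"
    hence "x \<notin> measure_support M" using assms by auto
    then obtain U where "open U" "x \<in> U" "emeasure M U = 0" unfolding measure_support_def by auto
    thus "x \<in> \<Union>F" unfolding F_def by auto
  qed
  ultimately show ?thesis unfolding F'(3) by (intro AE_I') auto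
qed

end

text \<open>The pairs \<open>(x, t)\<close> do not form a compact set, so compactness is applied to
  triples from \<open>A\<close>. A linear expression in the triple vanishes exactly on
  configurations; where the first two points stay apart it is therefore bounded away from 0 on
  \<open>A\<close>, whereas three points of \<open>A\<close> close to a configuration would make it
  small.\<close>

lemma no_config_separation:
  fixes A :: "real set"
  assumes A: "compact A" and \<gamma>1: "\<gamma>1 \<noteq> 0" and \<delta>: "0 < \<delta>"
    and none: "\<And>x t. t \<noteq> 0 \<Longrightarrow> \<not> {x, x - \<gamma>1 * t, x - \<gamma>2 * t} \<subseteq> A"
  obtains \<eta> where "0 < \<eta>"
    "\<And>x t. \<delta> \<le> \<bar>t\<bar> \<Longrightarrow> \<exists>p\<in>{x, x - \<gamma>1 * t, x - \<gamma>2 * t}. \<forall>y\<in>A. \<eta> \<le> \<bar>p - y\<bar>"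
proof -
  define h where "h q = \<bar>(fst q - snd (snd q)) * \<gamma>1 - (fst q - fst (snd q)) * \<gamma>2\<bar>" for q :: "real \<times> real \<times> real"
  \<comment> \<open>Half of \<open>\<bar>\<gamma>1\<bar> * \<delta>\<close> is given up, because
    points of \<open>A\<close> only approximate \<open>x\<close> and
    \<open>x - \<gamma>1 * t\<close>, whose distance is at least
    \<open>\<bar>\<gamma>1\<bar> * \<delta>\<close>.\<close>
  define K where "K = (A \<times> A \<times> A) \<inter> {q. \<bar>\<gamma>1\<bar> * \<delta> / 2 \<le> \<bar>fst q - fst (snd q)\<bar>}"
  have "closed {q :: real \<times> real \<times> real. \<bar>\<gamma>1\<bar> * \<delta> / 2 \<le> \<bar>fst q - fst (snd q)\<bar>}"
    by (intro closed_Collect_le continuous_intros)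
  hence K: "compact K" unfolding K_def by (intro compact_Int_closed compact_Times A)
  have hpos: "0 < h q" if q: "q \<in> K" for q
  proof (rule ccontr)
    obtain a b c where abc: "q = (a, b, c)" by (cases q) auto
    assume "\<not> 0 < h q"
    hence eq: "(a - c) * \<gamma>1 = (a - b) * \<gamma>2" unfolding h_def abc by simp
    define t where "t = (a - b) / \<gamma>1"
    have t: "a - b = t * \<gamma>1" using \<gamma>1 by (simp add: t_def)
    have "(a - c) * \<gamma>1 = (t * \<gamma>2) * \<gamma>1" unfolding eq t by simp
    hence "a - c = t * \<gamma>2" using \<gamma>1 by simp
    moreover have "0 < \<bar>\<gamma>1\<bar> * \<delta> / 2" using \<gamma>1 \<delta> by simp
    hence "a \<noteq> b" using q unfolding K_def abc by auto
    ultimately have "t \<noteq> 0" "a - \<gamma>1 * t = b" "a - \<gamma>2 * t = c" using t by (auto simp: algebra_simps)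
    thus False using none[of t a] q unfolding K_def abc by auto
  qed
  obtain m where m: "0 < m" "\<And>q. q \<in> K \<Longrightarrow> m \<le> h q"
  proof (cases "K = {}")
    case True thus ?thesis using that[of 1] by auto
  next
    case False
    have "continuous_on K h" unfolding h_def by (intro continuous_intros)
    from continuous_attains_inf[OF K False this] show ?thesis using hpos that by metis
  qed
  \<comment> \<open>The first bound keeps the approximating triple in \<open>K\<close>; the second
    makes \<open>h\<close> smaller on it than its minimum \<open>m\<close>.\<close>
  define \<eta> where "\<eta> = min (\<bar>\<gamma>1\<bar> * \<delta> / 4) (m / (2 * (\<bar>\<gamma>1\<bar> + \<bar>\<gamma>2\<bar>)))"
  have \<eta>: "0 < \<eta>" "2 * \<eta> \<le> \<bar>\<gamma>1\<bar> * \<delta> / 2" "2 * \<eta> * (\<bar>\<gamma>1\<bar> + \<bar>\<gamma>2\<bar>) \<le> m"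
  proof -
    have p: "0 < \<bar>\<gamma>1\<bar> + \<bar>\<gamma>2\<bar>" using \<gamma>1 by simp
    show "0 < \<eta>" using \<gamma>1 \<delta> m(1) p by (auto simp: \<eta>_def)
    show "2 * \<eta> \<le> \<bar>\<gamma>1\<bar> * \<delta> / 2" by (simp add: \<eta>_def)
    have "\<eta> \<le> m / (2 * (\<bar>\<gamma>1\<bar> + \<bar>\<gamma>2\<bar>))" by (simp add: \<eta>_def)
    thus "2 * \<eta> * (\<bar>\<gamma>1\<bar> + \<bar>\<gamma>2\<bar>) \<le> m" using p by (simp add: pos_le_divide_eq mult_ac)
  qed
  have "\<exists>p\<in>{x, x - \<gamma>1 * t, x - \<gamma>2 * t}. \<forall>y\<in>A. \<eta> \<le> \<bar>p - y\<bar>" if t: "\<delta> \<le> \<bar>t\<bar>" for x t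
  proof (rule ccontr)
    assume "\<not> ?thesis"
    then obtain a b c where abc: "a \<in> A" "b \<in> A" "c \<in> A"
      "\<bar>x - a\<bar> < \<eta>" "\<bar>x - \<gamma>1 * t - b\<bar> < \<eta>" "\<bar>x - \<gamma>2 * t - c\<bar> < \<eta>"
      by (auto simp: not_le)
    have "\<bar>\<gamma>1\<bar> * \<delta> \<le> \<bar>\<gamma>1 * t\<bar>" using t by (simp add: abs_mult mult_left_mono)
    also have "\<gamma>1 * t = (a - b) + (x - a) - (x - \<gamma>1 * t - b)" by simp
    also have "\<bar>\<dots>\<bar> \<le> \<bar>a - b\<bar> + \<bar>x - a\<bar> + \<bar>x - \<gamma>1 * t - b\<bar>" by linarith
    finally have "\<bar>\<gamma>1\<bar> * \<delta> / 2 \<le> \<bar>a - b\<bar>" using abc \<eta>(2) by linarith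
    hence "m \<le> h (a, b, c)" using abc by (intro m) (auto simp: K_def)
    \<comment> \<open>The expression under the absolute value is zero at the exact configuration, so
      only the three approximation errors remain.\<close>
    also have "h (a, b, c) = \<bar>((a - x) - (c - (x - \<gamma>2 * t))) * \<gamma>1 - ((a - x) - (b - (x - \<gamma>1 * t))) * \<gamma>2\<bar>"
      unfolding h_def by (simp add: algebra_simps)
    also have "\<dots> \<le> \<bar>(a - x) - (c - (x - \<gamma>2 * t))\<bar> * \<bar>\<gamma>1\<bar> + \<bar>(a - x) - (b - (x - \<gamma>1 * t))\<bar> * \<bar>\<gamma>2\<bar>"
      unfolding abs_mult[symmetric] by (rule abs_triangle_ineq4)
    also have "\<dots> < 2 * \<eta> * \<bar>\<gamma>1\<bar> + 2 * \<eta> * \<bar>\<gamma>2\<bar>"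
      using abc \<gamma>1 by (intro add_less_le_mono mult_strict_right_mono mult_right_mono) auto
    finally show False using \<eta>(3) by (simp add: distrib_left)
  qed
  thus ?thesis using that \<eta>(1) by blast
qed

text \<open>One distant point contributes the exponential over \<sigma> and each of the other two at
  most \<open>1 / \<sigma>\<close>, whence the cube. With
  \<open>y = \<eta>\<^sup>2 / (2 * \<sigma>\<^sup>2)\<close>, the bound
  \<open>y\<^sup>2 / 2 \<le> exp y\<close> is worth four powers of \<sigma>, one more than
  needed.\<close>

lemma exp_gauss_tail_le:
  fixes \<eta> \<sigma> :: real
  assumes "0 < \<eta>" "0 < \<sigma>"
  shows "exp (- \<eta>\<^sup>2 / (2 * \<sigma>\<^sup>2)) / \<sigma> ^ 3 \<le> 8 * \<sigma> / \<eta> ^ 4"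
proof -
  define y where "y = \<eta>\<^sup>2 / (2 * \<sigma>\<^sup>2)"
  have y: "0 < y" using assms by (simp add: y_def)
  have "y\<^sup>2 / 2 \<le> exp y" using exp_lower_Taylor_quadratic[of y] y by simp
  hence "exp (- y) \<le> 2 / y\<^sup>2" using y by (simp add: exp_minus field_simps)
  also have "2 / y\<^sup>2 = 8 * \<sigma> ^ 4 / \<eta> ^ 4"
    using assms by (simp add: y_def power_divide power_mult_distrib flip: power_mult)
  finally have "exp (- y) / \<sigma> ^ 3 \<le> 8 * \<sigma> ^ 4 / \<eta> ^ 4 / \<sigma> ^ 3"
    using assms by (intro divide_right_mono) auto
  also have "\<dots> = 8 * \<sigma> / \<eta> ^ 4" using assms by (simp add: power_numeral_reduce)
  finally show ?thesis by (simp add: y_def)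
qed

lemma one_minus_cos_le: "1 - cos t \<le> t\<^sup>2 / 2" for t :: real
proof -
  have "1 - cos t = 2 * (sin (t / 2))\<^sup>2" using cos_double_sin[of "t / 2"] by simp
  also have "\<dots> \<le> 2 * (t / 2)\<^sup>2"
    using abs_sin_x_le_abs_x[of "t / 2"] by (simp add: abs_le_square_iff[symmetric])
  finally show ?thesis by (simp add: power_divide)
qed

text \<open>The threshold \<sigma>1 depends on the set through the separation \<eta>, so by itself
  this says nothing uniform about a sequence of measures.\<close>

lemma (in real_distribution) config_mass_small_if_no_config:
  assumes \<gamma>: "\<gamma>1 \<noteq> 0" "\<gamma>2 \<noteq> 0" "\<gamma>1 \<noteq> \<gamma>2" and B: "0 \<le> B" "cube_int (char M) \<le> ennreal B"
    and A: "compact A" "measure_support M \<subseteq> A"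
    and none: "\<And>x t. t \<noteq> 0 \<Longrightarrow> \<not> {x, x - \<gamma>1 * t, x - \<gamma>2 * t} \<subseteq> A" and e: "0 < e"
  obtains \<sigma>1 where "0 < \<sigma>1" "\<And>\<sigma>. 0 < \<sigma> \<Longrightarrow> \<sigma> \<le> \<sigma>1 \<Longrightarrow> config_mass \<gamma>1 \<gamma>2 M \<sigma> \<le> e"
proof -
  interpret G: prob_space gauss_plane by (rule prob_space_gauss_plane)
  define L where "L = 3 * config_const \<gamma>1 \<gamma>2 * B"
  have L: "0 \<le> L" unfolding L_def using B config_const_nonneg by simp
  \<comment> \<open>Chosen so that \<open>\<delta>\<^sup>2 / 2 * L\<close> is at most
    \<open>e / 2\<close>, also when \<open>L = 0\<close>.\<close>
  define \<delta> where "\<delta> = sqrt (e / (L + 1))"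
  have \<delta>: "0 < \<delta>" and \<delta>2: "\<delta>\<^sup>2 = e / (L + 1)" using e L by (auto simp: \<delta>_def)
  obtain \<eta> where \<eta>: "0 < \<eta>"
    "\<And>x t. \<delta> \<le> \<bar>t\<bar> \<Longrightarrow> \<exists>p\<in>{x, x - \<gamma>1 * t, x - \<gamma>2 * t}. \<forall>y\<in>A. \<eta> \<le> \<bar>p - y\<bar>"
    using no_config_separation[OF A(1) \<gamma>(1) \<delta> none] by blast
  \<comment> \<open>At this scale the tail contribution
    \<open>2 * (8 * \<sigma>1 / \<eta> ^ 4)\<close> equals \<open>e / 2\<close>.\<close>
  define \<sigma>1 where "\<sigma>1 = e * \<eta> ^ 4 / 32"
  have "config_mass \<gamma>1 \<gamma>2 M \<sigma> \<le> e" if \<sigma>: "0 < \<sigma>" "\<sigma> \<le> \<sigma>1" for \<sigma>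
  proof -
    let ?f = "mollify M \<sigma>"
    let ?m = "\<lambda>z. ?f (fst z) * ?f (fst z - \<gamma>1 * snd z) * ?f (fst z - \<gamma>2 * snd z)"
    define E where "E = exp (- \<eta>\<^sup>2 / (2 * \<sigma>\<^sup>2))"
    have E: "0 \<le> E" by (simp add: E_def)
    have m0: "0 \<le> ?m z" for z by (intro mult_nonneg_nonneg mollify_nonneg)
    have far: "?f p \<le> E / \<sigma>" if "\<forall>y\<in>A. \<eta> \<le> \<bar>p - y\<bar>" for p
      unfolding E_def using \<sigma> \<eta> AE_in_closed_support[OF A(2)] that
      by (intro mollify_le_far) (auto elim: AE_mp)
    have E1: "E / \<sigma> * (1 / \<sigma>) * (1 / \<sigma>) = E / \<sigma> ^ 3" by (simp add: power3_eq_cube)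
    have mfar: "?m z \<le> E / \<sigma> ^ 3" if z: "\<delta> \<le> \<bar>snd z\<bar>" for z
    proof -
      from \<eta>(2)[OF z, of "fst z"] consider "\<forall>y\<in>A. \<eta> \<le> \<bar>fst z - y\<bar>"
        | "\<forall>y\<in>A. \<eta> \<le> \<bar>(fst z - \<gamma>1 * snd z) - y\<bar>" | "\<forall>y\<in>A. \<eta> \<le> \<bar>(fst z - \<gamma>2 * snd z) - y\<bar>" by blast
      hence "?m z \<le> E / \<sigma> * (1 / \<sigma>) * (1 / \<sigma>) \<or> ?m z \<le> (1 / \<sigma>) * (E / \<sigma>) * (1 / \<sigma>) \<or> ?m z \<le> (1 / \<sigma>) * (1 / \<sigma>) * (E / \<sigma>)"
        by cases (use \<sigma> E in \<open>blast intro!: mult_mono mollify_le mollify_nonneg far mult_nonneg_nonneg divide_nonneg_pos zero_le_one\<close>)+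
      thus ?thesis by (simp add: E1[symmetric])
    qed
    \<comment> \<open>For small \<open>t\<close> the factor \<open>1 - cos t\<close> is small against the form without it, which is bounded;
      otherwise one of the three points is at distance at least \<open>\<eta>\<close> from \<open>A\<close>.\<close>
    have pt: "(1 - cos (snd z)) * ?m z \<le> \<delta>\<^sup>2 / 2 * (cos (0 * snd z) * ?m z) + 2 * (E / \<sigma> ^ 3)" for z
    proof (cases "\<delta> \<le> \<bar>snd z\<bar>")
      case True
      have "(1 - cos (snd z)) * ?m z \<le> 2 * (E / \<sigma> ^ 3)"
        using mfar[OF True] m0 cos_ge_minus_one[of "snd z"] by (intro mult_mono) auto
      moreover have "0 \<le> \<delta>\<^sup>2 / 2 * (cos (0 * snd z) * ?m z)" using m0[of z] by simp
      ultimately show ?thesis by linarith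
    next
      case False
      hence "(snd z)\<^sup>2 \<le> \<delta>\<^sup>2" using \<delta> by (simp add: abs_le_square_iff[symmetric])
      hence "1 - cos (snd z) \<le> \<delta>\<^sup>2 / 2" using one_minus_cos_le[of "snd z"] by linarith
      hence "(1 - cos (snd z)) * ?m z \<le> \<delta>\<^sup>2 / 2 * ?m z" using m0 by (intro mult_right_mono) auto
      moreover have "0 \<le> 2 * (E / \<sigma> ^ 3)" using E \<sigma> by simp
      ultimately show ?thesis by simp
    qed
    have i0: "integrable gauss_plane (\<lambda>z. cos (0 * snd z) * ?m z)"
      using integrable_config_mollify[OF \<sigma>(1), of "\<lambda>_. 1" 1] by simp
    have "\<bar>1 - cos t\<bar> \<le> 2" for t :: real using cos_ge_minus_one[of t] cos_le_one[of t] by linarith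
    hence i1: "integrable gauss_plane (\<lambda>z. (1 - cos (snd z)) * ?m z)"
      by (intro integrable_config_mollify[OF \<sigma>(1), of "\<lambda>t. 1 - cos t" 2]) auto
    have "config_mass \<gamma>1 \<gamma>2 M \<sigma> \<le> (\<integral>z. \<delta>\<^sup>2 / 2 * (cos (0 * snd z) * ?m z) + 2 * (E / \<sigma> ^ 3) \<partial>gauss_plane)"
      unfolding config_mass_def using i0
      by (intro integral_mono i1 pt Bochner_Integration.integrable_add integrable_mult_right G.integrable_const)
    also have "\<dots> = \<delta>\<^sup>2 / 2 * (\<integral>z. cos (0 * snd z) * ?m z \<partial>gauss_plane) + 2 * (E / \<sigma> ^ 3)"
      using i0 by (subst Bochner_Integration.integral_add) (auto simp: G.prob_space)
    also have "\<dots> \<le> \<delta>\<^sup>2 / 2 * L + 2 * (8 * \<sigma> / \<eta> ^ 4)"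
    proof (intro add_mono mult_left_mono)
      show "(\<integral>z. cos (0 * snd z) * ?m z \<partial>gauss_plane) \<le> L"
        unfolding Re_config_form_mollify[OF \<sigma>(1), symmetric] L_def
        using config_form_mollify_bound[OF \<gamma> B \<sigma>(1)] complex_Re_le_cmod order_trans by blast
      show "E / \<sigma> ^ 3 \<le> 8 * \<sigma> / \<eta> ^ 4" unfolding E_def by (rule exp_gauss_tail_le[OF \<eta>(1) \<sigma>(1)])
    qed auto
    also have "\<delta>\<^sup>2 / 2 * L = e / 2 * (L / (L + 1))" unfolding \<delta>2 by simp
    also have "\<dots> \<le> e / 2 * 1" using e L by (intro mult_left_mono) auto
    also have "2 * (8 * \<sigma> / \<eta> ^ 4) \<le> 2 * (8 * \<sigma>1 / \<eta> ^ 4)"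
      using \<sigma> \<eta> by (intro mult_left_mono divide_right_mono) auto
    also have "\<dots> = e / 2" using \<eta>(1) by (simp add: \<sigma>1_def)
    finally show ?thesis by simp
  qed
  moreover have "0 < \<sigma>1" using e \<eta> by (simp add: \<sigma>1_def)
  ultimately show ?thesis using that by blast
qed

section \<open>Passage to a weak limit at a fixed scale\<close>

lemma weak_conv_mollify:
  assumes M: "\<And>n. real_distribution (M n)" "real_distribution N" "weak_conv_m M N" and \<sigma>: "0 < \<sigma>"
  shows "(\<lambda>n. mollify (M n) \<sigma> x) \<longlonglongrightarrow> mollify N \<sigma> x"
  unfolding mollify_def
proof (rule weak_conv_imp_integral_bdd_continuous_conv[OF M(1,2,3)])
  show "norm (normal_density y \<sigma> x) \<le> 1 / \<sigma>" for y
    using normal_density_le[OF \<sigma>, of 0] by (auto simp: normal_density_nonneg)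
  show "isCont (\<lambda>y. normal_density y \<sigma> x) y" for y
    unfolding normal_density_def using \<sigma> by (intro continuous_intros) auto
qed

text \<open>At fixed \<sigma> the integrands are dominated by the constant
  \<open>2 / \<sigma> ^ 3\<close>, integrable for a probability measure, so pointwise convergence of
  the mollified densities is enough.\<close>

lemma weak_conv_config_mass:
  assumes M: "\<And>n. real_distribution (M n)" "real_distribution N" "weak_conv_m M N" and \<sigma>: "0 < \<sigma>"
  shows "(\<lambda>n. config_mass \<gamma>1 \<gamma>2 (M n) \<sigma>) \<longlonglongrightarrow> config_mass \<gamma>1 \<gamma>2 N \<sigma>"
  unfolding config_mass_def
proof (rule integral_dominated_convergence[where w="\<lambda>_. 2 * (1 / \<sigma> * (1 / \<sigma>) * (1 / \<sigma>))"])
  interpret G: prob_space gauss_plane by (rule prob_space_gauss_plane)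
  interpret N: real_distribution N by fact
  interpret M: real_distribution "M n" for n by fact
  note [measurable] = N.borel_measurable_mollify M.borel_measurable_mollify
  show "integrable gauss_plane (\<lambda>_. 2 * (1 / \<sigma> * (1 / \<sigma>) * (1 / \<sigma>)))" by simp
  show "AE z in gauss_plane. (\<lambda>n. (1 - cos (snd z)) * (mollify (M n) \<sigma> (fst z) *
      mollify (M n) \<sigma> (fst z - \<gamma>1 * snd z) * mollify (M n) \<sigma> (fst z - \<gamma>2 * snd z))) \<longlonglongrightarrow>
      (1 - cos (snd z)) * (mollify N \<sigma> (fst z) * mollify N \<sigma> (fst z - \<gamma>1 * snd z) * mollify N \<sigma> (fst z - \<gamma>2 * snd z))"
    by (intro AE_I2 tendsto_intros weak_conv_mollify assms)
  have c: "\<bar>1 - cos t\<bar> \<le> 2" for t :: real using cos_ge_minus_one[of t] cos_le_one[of t] by linarith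
  show "AE z in gauss_plane. norm ((1 - cos (snd z)) * (mollify (M n) \<sigma> (fst z) *
      mollify (M n) \<sigma> (fst z - \<gamma>1 * snd z) * mollify (M n) \<sigma> (fst z - \<gamma>2 * snd z))) \<le>
      2 * (1 / \<sigma> * (1 / \<sigma>) * (1 / \<sigma>))" for n
    unfolding real_norm_def abs_mult abs_of_nonneg[OF M.mollify_nonneg]
    by (intro AE_I2 mult_mono c M.mollify_le M.mollify_nonneg mult_nonneg_nonneg \<sigma>) (use \<sigma> in auto)
  show "(\<lambda>z. (1 - cos (snd z)) * (mollify N \<sigma> (fst z) * mollify N \<sigma> (fst z - \<gamma>1 * snd z) *
      mollify N \<sigma> (fst z - \<gamma>2 * snd z))) \<in> borel_measurable gauss_plane" by measurable
  show "(\<lambda>z. (1 - cos (snd z)) * (mollify (M n) \<sigma> (fst z) * mollify (M n) \<sigma> (fst z - \<gamma>1 * snd z) *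
      mollify (M n) \<sigma> (fst z - \<gamma>2 * snd z))) \<in> borel_measurable gauss_plane" for n by measurable
qed

subsection \<open>Lower bound for measures of linear growth\<close>

lemma emeasure_lborel_compact_lt_top: "compact (E :: real set) \<Longrightarrow> emeasure lborel E < \<infinity>"
  using emeasure_bounded_finite[OF compact_imp_bounded] by simp

lemma emeasure_lborel_compact: "compact (E :: real set) \<Longrightarrow> emeasure lborel E = ennreal (measure lborel E)"
  using emeasure_lborel_compact_lt_top[of E] by (intro emeasure_eq_ennreal_measure) auto

text \<open>Continuity from above along closed neighbourhoods of radius \<open>1 / Suc n\<close>:
  they have finite length because \<open>E\<close> is bounded, and they shrink to \<open>E\<close>
  because it is closed.\<close>

lemma measure_thickening_le:
  fixes E :: "real set"
  assumes E: "compact E" "E \<noteq> {}" and e: "0 < e"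
  obtains \<delta> where "0 < \<delta>" "measure lborel {x. infdist x E \<le> \<delta>} \<le> measure lborel E + e"
proof -
  define A where "A n = {x. infdist x E \<le> 1 / Suc n}" for n
  have cA: "compact (A n)" for n unfolding A_def by (intro compact_infdist_le E) auto
  have "(\<Inter>n. A n) = E"
  proof safe
    fix x assume x: "x \<in> (\<Inter>n. A n)"
    have "infdist x E \<le> 0"
    proof (rule field_le_epsilon)
      fix r :: real assume "0 < r"
      then obtain n where "inverse (Suc n) < r" using reals_Archimedean by blast
      thus "infdist x E \<le> 0 + r" using x by (auto simp: A_def inverse_eq_divide dest!: spec[of _ n])
    qed
    thus "x \<in> E" using E in_closed_iff_infdist_zero[of E x] infdist_nonneg[of x E]
      by (auto dest: compact_imp_closed)
  qed (auto simp: A_def)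
  moreover have "(\<lambda>n. measure lborel (A n)) \<longlonglongrightarrow> measure lborel (\<Inter>n. A n)"
  proof (rule Lim_measure_decseq)
    show "range A \<subseteq> sets lborel" using cA by (auto intro: borel_compact)
    show "decseq A" unfolding A_def decseq_def
    proof safe
      fix m n x assume mn: "m \<le> n" and "infdist x E \<le> 1 / real (Suc n)"
      moreover have "1 / real (Suc n) \<le> 1 / real (Suc m)" using mn by (intro divide_left_mono) auto
      ultimately show "infdist x E \<le> 1 / real (Suc m)" by linarith
    qed
    show "emeasure lborel (A i) \<noteq> \<infinity>" for i
      by (rule less_imp_neq[OF emeasure_lborel_compact_lt_top[OF cA]])
  qed
  ultimately have "(\<lambda>n. measure lborel (A n)) \<longlonglongrightarrow> measure lborel E" by simp
  hence "eventually (\<lambda>n. measure lborel (A n) < measure lborel E + e) sequentially"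
    using e by (intro order_tendstoD) auto
  then obtain n where "measure lborel (A n) < measure lborel E + e" by (auto simp: eventually_sequentially)
  thus ?thesis using that[of "1 / Suc n"] unfolding A_def by auto
qed

section \<open>A compact set on which the measure dominates length\<close>

context real_distribution
begin

text \<open>Averaging over centres replaces a covering argument. Integrate over pairs with
  \<open>y\<close> in \<open>E\<close> and \<open>\<bar>x - y\<bar> < r\<close>: length in
  \<open>x\<close> gives \<open>2 * r\<close> times the mass of \<open>E\<close>, while mass in
  \<open>y\<close> is at most \<open>C * r\<close> and is present only for \<open>x\<close> in the
  \<open>r\<close>-neighbourhood of \<open>E\<close>. The factor \<open>r\<close> cancels.\<close>

lemma measure_compact_le_lborel:
  assumes C: "\<And>x r. 0 < r \<Longrightarrow> measure M (ball x r) \<le> C * r" and E: "compact E" "E \<noteq> {}"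
  shows "2 * measure M E \<le> C * measure lborel E"
proof (rule field_le_epsilon)
  fix e :: real assume e: "0 < e"
  have C0: "0 \<le> C" using C[of 1 0] measure_nonneg[of M "ball 0 1"] by linarith
  interpret LM: pair_sigma_finite "lborel :: real measure" M ..
  have [measurable]: "E \<in> sets borel" by (rule borel_compact[OF E(1)])
  have "0 < e / (C + 1)" using e C0 by simp
  then obtain r where r: "0 < r" "measure lborel {x. infdist x E \<le> r} \<le> measure lborel E + e / (C + 1)"
    using measure_thickening_le[OF E] by blast
  define F where "F = {x. infdist x E \<le> r}"
  have F: "compact F" unfolding F_def by (intro compact_infdist_le E r)
  have [measurable]: "F \<in> sets borel" by (rule borel_compact[OF F])
  have "ennreal (2 * r) * emeasure M E = (\<integral>\<^sup>+y. ennreal (2 * r) * indicator E y \<partial>M)"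
    by (simp add: nn_integral_cmult)
  \<comment> \<open>The ball is written as a half-line condition on
    \<open>r - \<bar>x - y\<bar>\<close>, which is symmetric in the two variables and visibly
    jointly measurable.\<close>
  also have "\<dots> = (\<integral>\<^sup>+y. \<integral>\<^sup>+x. indicator E y * indicator {0<..} (r - \<bar>x - y\<bar>) \<partial>lborel \<partial>M)"
  proof (rule nn_integral_cong)
    fix y
    have "(\<integral>\<^sup>+x. indicator {0<..} (r - \<bar>x - y\<bar>) \<partial>lborel) = (\<integral>\<^sup>+x. indicator (ball y r) x \<partial>lborel)"
      by (intro nn_integral_cong) (auto simp: indicator_def dist_real_def)
    also have "\<dots> = ennreal (2 * r)" using r by (simp add: ball_eq_greaterThanLessThan)
    finally show "ennreal (2 * r) * indicator E y = (\<integral>\<^sup>+x. indicator E y * indicator {0<..} (r - \<bar>x - y\<bar>) \<partial>lborel)"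
      by (simp add: nn_integral_cmult mult.commute)
  qed
  also have "\<dots> = (\<integral>\<^sup>+x. \<integral>\<^sup>+y. indicator E y * indicator {0<..} (r - \<bar>x - y\<bar>) \<partial>M \<partial>lborel)"
    by (rule LM.Fubini') measurable
  also have "\<dots> \<le> (\<integral>\<^sup>+x. ennreal (C * r) * indicator F x \<partial>lborel)"
  proof (rule nn_integral_mono)
    fix x
    have "(\<integral>\<^sup>+y. indicator E y * indicator {0<..} (r - \<bar>x - y\<bar>) \<partial>M) \<le> (\<integral>\<^sup>+y. indicator F x * indicator (ball x r) y \<partial>M)"
    proof (rule nn_integral_mono)
      fix y
      have "x \<in> F" if "y \<in> E" "\<bar>x - y\<bar> < r"
        using infdist_le[OF that(1), of x] that(2) by (auto simp: F_def dist_real_def)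
      thus "indicator E y * indicator {0<..} (r - \<bar>x - y\<bar>) \<le> (indicator F x * indicator (ball x r) y :: ennreal)"
        by (auto simp: indicator_def dist_real_def)
    qed
    also have "\<dots> = indicator F x * emeasure M (ball x r)"
      by (rule nn_integral_cmult_indicator) simp
    also have "\<dots> \<le> indicator F x * ennreal (C * r)"
      using C[OF r(1)] by (intro mult_left_mono) (auto simp: emeasure_eq_measure intro: ennreal_leI)
    finally show "(\<integral>\<^sup>+y. indicator E y * indicator {0<..} (r - \<bar>x - y\<bar>) \<partial>M) \<le> ennreal (C * r) * indicator F x"
      by (simp add: mult.commute)
  qed
  also have "\<dots> = ennreal (C * r) * ennreal (measure lborel F)"
    by (simp add: nn_integral_cmult emeasure_lborel_compact[OF F])
  finally have "ennreal (2 * r * measure M E) \<le> ennreal (C * r * measure lborel F)"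
    using r C0 by (simp add: emeasure_eq_measure ennreal_mult)
  hence "2 * r * measure M E \<le> C * r * measure lborel F"
    using r C0 by (subst (asm) ennreal_le_iff) auto
  hence "r * (2 * measure M E) \<le> r * (C * measure lborel F)" by (simp add: mult_ac)
  hence "2 * measure M E \<le> C * measure lborel F" using r by simp
  also have "\<dots> \<le> C * (measure lborel E + e / (C + 1))"
    using r C0 unfolding F_def by (intro mult_left_mono) auto
  also have "\<dots> = C * measure lborel E + e * (C / (C + 1))" by (simp add: algebra_simps)
  also have "\<dots> \<le> C * measure lborel E + e * 1" using e C0 by (intro add_left_mono mult_left_mono) auto
  finally show "2 * measure M E \<le> C * measure lborel E + e" by simp
qed

text \<open>A Hahn decomposition of a large ball against a small multiple of length takes the place
  of a density. Off \<open>Y\<close> the mass is at most the total 1/4 of that multiple, while the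
  ball carries more than 1/2, so \<open>Y\<close> has positive mass. Inner regularity supplies a
  compact part of \<open>Y\<close>, and the preceding lemma turns its positive mass into positive
  length.\<close>

lemma lborel_minorant_on_compact:
  assumes C: "\<And>x r. 0 < r \<Longrightarrow> measure M (ball x r) \<le> C * r"
  obtains E c where "compact E" "0 < c" "0 < measure lborel E"
    "\<And>S. S \<in> sets borel \<Longrightarrow> S \<subseteq> E \<Longrightarrow> ennreal c * emeasure lborel S \<le> emeasure M S"
proof -
  have "(\<lambda>n. measure M (cball 0 (real n))) \<longlonglongrightarrow> measure M (\<Union>n. cball 0 (real n))"
    by (rule finite_Lim_measure_incseq) (auto simp: incseq_def)
  moreover have "(\<Union>n. cball 0 (real n)) = (UNIV :: real set)"
    using real_arch_simple by (auto simp: dist_real_def)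
  ultimately have "(\<lambda>n. measure M (cball 0 (real n))) \<longlonglongrightarrow> 1" using prob_space by simp
  hence "eventually (\<lambda>n. 1 / 2 < measure M (cball 0 (real n))) sequentially"
    by (rule order_tendstoD) simp
  hence "eventually (\<lambda>n. 1 / 2 < measure M (cball 0 (real n)) \<and> 0 < n) sequentially"
    using eventually_gt_at_top[of 0] by eventually_elim simp
  then obtain n where n: "1 / 2 < measure M (cball 0 (real n))" "0 < n"
    by (auto simp: eventually_sequentially)
  define R where "R = real n"
  have R: "1 / 2 < measure M (cball 0 R)" "0 < R" using n by (auto simp: R_def)
  \<comment> \<open>The ball has length \<open>2 * R\<close>, so it gets measure 1/4 under
    \<open>N\<close>.\<close>
  define c where "c = 1 / (8 * R)"
  have c: "0 < c" using R by (simp add: c_def)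
  define N where "N = scale_measure (ennreal c) (lborel :: real measure)"
  have NK: "emeasure N (cball 0 R) = ennreal (1 / 4)"
    using R c by (simp add: N_def cball_eq_atLeastAtMost ennreal_mult'[symmetric] c_def)
  obtain Y where Y: "Y \<in> sets M" "Y \<subseteq> cball 0 R" "\<forall>X\<in>sets M. X \<subseteq> Y \<longrightarrow> N X \<le> M X"
     "\<forall>X\<in>sets M. X \<subseteq> cball 0 R \<longrightarrow> X \<inter> Y = {} \<longrightarrow> M X \<le> N X"
    using unsigned_Hahn_decomposition[of N M "cball 0 R"] NK by (auto simp: N_def)
  have "emeasure M (cball 0 R - Y) \<le> emeasure N (cball 0 R - Y)"
    using Y(1) by (intro Y(4)[rule_format]) auto
  also have "\<dots> \<le> emeasure N (cball 0 R)" by (intro emeasure_mono) (auto simp: N_def)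
  finally have "measure M (cball 0 R - Y) \<le> 1 / 4" unfolding NK by (simp add: emeasure_eq_measure)
  moreover have "measure M (cball 0 R - Y) = measure M (cball 0 R) - measure M Y"
    using Y(1,2) by (intro finite_measure_Diff) auto
  ultimately have "0 < measure M Y" using R by linarith
  hence "0 < emeasure M Y" by (simp add: emeasure_eq_measure)
  also have "emeasure M Y = (SUP K\<in>{K. K \<subseteq> Y \<and> compact K}. emeasure M K)"
    using Y(1) by (intro inner_regular) auto
  finally obtain E where E: "E \<subseteq> Y" "compact E" "0 < emeasure M E" by (auto simp: less_SUP_iff)
  have "E \<noteq> {}" using E by auto
  have "0 < 2 * measure M E" using E by (simp add: emeasure_eq_measure)
  also have "\<dots> \<le> C * measure lborel E" by (rule measure_compact_le_lborel[OF C E(2) \<open>E \<noteq> {}\<close>])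
  finally have "0 < measure lborel E" by (metis less_eq_real_def measure_nonneg mult_zero_right less_irrefl)
  moreover have "ennreal c * emeasure lborel S \<le> emeasure M S" if "S \<in> sets borel" "S \<subseteq> E" for S
  proof -
    have "N S \<le> M S" using Y(3) that E by auto
    thus ?thesis by (simp add: N_def)
  qed
  ultimately show ?thesis using that[OF E(2) c] by blast
qed

end

text \<open>The proportion of the interval of radius \<sigma> about \<open>x\<close> that lies in
  \<open>E\<close>. Integrating over the offset \<open>w\<close> exhibits it as an average of
  translates of the indicator, ready for Fubini.\<close>

definition share :: "real set \<Rightarrow> real \<Rightarrow> real \<Rightarrow> real" where
  "share E \<sigma> x = (\<integral>w. indicator E (x - w) * indicator {-\<sigma>..\<sigma>} w \<partial>lborel) / (2 * \<sigma>)"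

lemma borel_measurable_share [measurable]:
  fixes E :: "real set"
  assumes [measurable]: "E \<in> sets borel"
  shows "share E \<sigma> \<in> borel_measurable borel"
  unfolding share_def[abs_def] by measurable

lemma integrable_share:
  fixes E :: "real set"
  assumes [measurable]: "E \<in> sets borel"
  shows "integrable lborel (\<lambda>w. indicator E (x - w) * indicator {-\<sigma>..\<sigma>} w :: real)"
proof (rule Bochner_Integration.integrable_bound)
  show "integrable lborel (indicator {-\<sigma>..\<sigma>} :: real \<Rightarrow> real)"
    by (rule integrable_real_indicator) (auto simp: emeasure_lborel_Icc_eq)
qed (auto simp: indicator_def)

lemma ennreal_share:
  fixes E :: "real set"
  assumes [measurable]: "E \<in> sets borel" and \<sigma>: "0 < \<sigma>"
  shows "ennreal (share E \<sigma> x) = ennreal (1 / (2 * \<sigma>)) * (\<integral>\<^sup>+w. indicator E (x - w) * indicator {-\<sigma>..\<sigma>} w \<partial>lborel)"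
proof -
  have "(\<integral>\<^sup>+w. indicator E (x - w) * indicator {-\<sigma>..\<sigma>} w \<partial>lborel) =
     (\<integral>\<^sup>+w. ennreal (indicator E (x - w) * indicator {-\<sigma>..\<sigma>} w) \<partial>lborel)"
    by (intro nn_integral_cong) (auto simp: indicator_def)
  also have "\<dots> = ennreal (\<integral>w. indicator E (x - w) * indicator {-\<sigma>..\<sigma>} w \<partial>lborel)"
    by (intro nn_integral_eq_integral integrable_share) auto
  finally show ?thesis using \<sigma> by (simp add: share_def ennreal_mult'[symmetric])
qed

lemma share_nonneg: "0 < \<sigma> \<Longrightarrow> 0 \<le> share E \<sigma> x"
  unfolding share_def by (intro divide_nonneg_pos Bochner_Integration.integral_nonneg) auto

lemma share_compl:
  fixes E :: "real set"
  assumes [measurable]: "E \<in> sets borel" and \<sigma>: "0 < \<sigma>"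
  shows "share (- E) \<sigma> x = 1 - share E \<sigma> x"
proof -
  have "share E \<sigma> x + share (- E) \<sigma> x =
    (\<integral>w. indicator E (x - w) * indicator {-\<sigma>..\<sigma>} w + indicator (- E) (x - w) * indicator {-\<sigma>..\<sigma>} w \<partial>lborel) / (2 * \<sigma>)"
    unfolding share_def by (subst Bochner_Integration.integral_add) (auto intro!: integrable_share simp: add_divide_distrib)
  also have "(\<lambda>w. indicator E (x - w) * indicator {-\<sigma>..\<sigma>} w + indicator (- E) (x - w) * indicator {-\<sigma>..\<sigma>} w) =
     (indicator {-\<sigma>..\<sigma>} :: real \<Rightarrow> real)"
    by (auto simp: indicator_def fun_eq_iff)
  finally show ?thesis using \<sigma> by simp
qed

lemma share_le_1: "E \<in> sets borel \<Longrightarrow> 0 < \<sigma> \<Longrightarrow> share E \<sigma> x \<le> 1"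
  using share_compl[of E \<sigma> x] share_nonneg[of \<sigma> "- E" x] by simp

text \<open>The part of \<open>E\<close> outside its translate by \<open>h\<close>, and the
  translate itself, are disjoint subsets of the \<delta>-neighbourhood. The translate has the length
  of \<open>E\<close>, so only the excess \<eta> is left for the other part. This is continuity of
  translations, uniform for \<open>\<bar>h\<bar> \<le> \<delta>\<close>.\<close>

lemma measure_Diff_translate_le:
  fixes E :: "real set"
  assumes E: "compact E" "E \<noteq> {}" and \<delta>: "0 < \<delta>" "\<bar>h\<bar> \<le> \<delta>"
    and m: "measure lborel {x. infdist x E \<le> \<delta>} \<le> measure lborel E + \<eta>"
  shows "(\<integral>\<^sup>+x. indicator E x * indicator (- E) (x - h) \<partial>lborel) \<le> ennreal \<eta>"
proof -
  define F where "F = {x. infdist x E \<le> \<delta>}"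
  have F: "compact F" unfolding F_def by (intro compact_infdist_le E \<delta>)
  have [measurable]: "F \<in> sets borel" "E \<in> sets borel" using F E by (auto intro: borel_compact)
  have "measure lborel E \<le> measure lborel F"
  proof (rule measure_mono_fmeasurable)
    show "E \<subseteq> F" using \<delta> by (auto simp: F_def)
    show "F \<in> fmeasurable lborel" using emeasure_lborel_compact_lt_top[OF F] by (auto intro: fmeasurableI)
  qed simp
  hence \<eta>: "0 \<le> \<eta>" using m unfolding F_def by linarith
  have sub: "x \<in> F" if "x - h \<in> E" for x
    using infdist_le[OF that, of x] \<delta> by (auto simp: F_def dist_real_def)
  have "(\<integral>\<^sup>+x. indicator E x * indicator (- E) (x - h) \<partial>lborel) + (\<integral>\<^sup>+x. indicator E (x - h) \<partial>lborel) =
     (\<integral>\<^sup>+x. indicator E x * indicator (- E) (x - h) + indicator E (x - h) \<partial>lborel)"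
    by (rule nn_integral_add[symmetric]) auto
  also have "\<dots> \<le> (\<integral>\<^sup>+x. indicator F x \<partial>lborel)"
  proof (rule nn_integral_mono)
    fix x
    have "E \<subseteq> F" using \<delta> by (auto simp: F_def)
    thus "indicator E x * indicator (- E) (x - h) + indicator E (x - h) \<le> (indicator F x :: ennreal)"
      using sub[of x] by (auto simp: indicator_def)
  qed
  also have "\<dots> = ennreal (measure lborel F)" by (simp add: emeasure_lborel_compact[OF F])
  also have "\<dots> \<le> ennreal (\<eta> + measure lborel E)" using m by (intro ennreal_leI) (simp add: F_def)
  also have "\<dots> = ennreal \<eta> + ennreal (measure lborel E)" using \<eta> by simp
  also have "(\<integral>\<^sup>+x. indicator E (x - h) \<partial>lborel) = (\<integral>\<^sup>+x. indicator E x \<partial>lborel)"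
    by (subst (2) nn_integral_real_affine[where c=1 and t="- h"]) auto
  also have "\<dots> = ennreal (measure lborel E)" by (simp add: emeasure_lborel_compact[OF E(1)])
  finally show ?thesis
    by (simp add: add.commute[of _ "ennreal (measure lborel E)"] ennreal_add_left_cancel_le)
qed

text \<open>The defect \<open>1 - share\<close> averages the indicator of the complement over
  offsets \<open>\<bar>w\<bar> \<le> \<sigma>\<close>. After Fubini each offset is a translation by
  \<open>\<tau> + w\<close>, of size at most \<delta>, so the preceding lemma applies to every one
  of them.\<close>

lemma nn_integral_share_compl_le:
  fixes E :: "real set"
  assumes E: "compact E" "E \<noteq> {}" and \<delta>: "\<bar>\<tau>\<bar> \<le> \<delta> / 2" "0 < \<sigma>" "\<sigma> \<le> \<delta> / 2"
    and m: "measure lborel {x. infdist x E \<le> \<delta>} \<le> measure lborel E + \<eta>"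
  shows "(\<integral>\<^sup>+x. indicator E x * ennreal (1 - share E \<sigma> (x - \<tau>)) \<partial>lborel) \<le> ennreal \<eta>"
proof -
  have [measurable]: "E \<in> sets borel" using E by (auto intro: borel_compact)
  have "(\<integral>\<^sup>+x. indicator E x * ennreal (1 - share E \<sigma> (x - \<tau>)) \<partial>lborel) =
    (\<integral>\<^sup>+x. ennreal (1 / (2 * \<sigma>)) * (\<integral>\<^sup>+w. indicator E x * (indicator (- E) (x - \<tau> - w) * indicator {-\<sigma>..\<sigma>} w) \<partial>lborel) \<partial>lborel)"
    by (intro nn_integral_cong)
       (simp add: share_compl[symmetric] \<delta> ennreal_share nn_integral_cmult mult_ac)
  also have "\<dots> = ennreal (1 / (2 * \<sigma>)) *
     (\<integral>\<^sup>+x. \<integral>\<^sup>+w. indicator E x * (indicator (- E) (x - \<tau> - w) * indicator {-\<sigma>..\<sigma>} w) \<partial>lborel \<partial>lborel)"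
    by (rule nn_integral_cmult) measurable
  also have "(\<integral>\<^sup>+x. \<integral>\<^sup>+w. indicator E x * (indicator (- E) (x - \<tau> - w) * indicator {-\<sigma>..\<sigma>} w) \<partial>lborel \<partial>lborel) =
     (\<integral>\<^sup>+w. \<integral>\<^sup>+x. indicator E x * (indicator (- E) (x - \<tau> - w) * indicator {-\<sigma>..\<sigma>} w) \<partial>lborel \<partial>lborel)"
    by (rule lborel_pair.Fubini'[symmetric]) measurable
  also have "\<dots> \<le> (\<integral>\<^sup>+w. ennreal \<eta> * indicator {-\<sigma>..\<sigma>} w \<partial>lborel)"
  proof (rule nn_integral_mono)
    fix w
    have "(\<integral>\<^sup>+x. indicator E x * (indicator (- E) (x - \<tau> - w) * indicator {-\<sigma>..\<sigma>} w) \<partial>lborel) =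
      (\<integral>\<^sup>+x. indicator E x * indicator (- E) (x - (\<tau> + w)) \<partial>lborel) * indicator {-\<sigma>..\<sigma>} w"
      by (subst nn_integral_multc[symmetric]) (auto simp: mult_ac algebra_simps)
    also have "\<dots> \<le> ennreal \<eta> * indicator {-\<sigma>..\<sigma>} w"
    proof (cases "w \<in> {-\<sigma>..\<sigma>}")
      case True
      hence "0 < \<delta>" "\<bar>\<tau> + w\<bar> \<le> \<delta>" using \<delta> by auto
      from measure_Diff_translate_le[OF E this m] show ?thesis by (intro mult_right_mono) auto
    qed simp
    finally show "(\<integral>\<^sup>+x. indicator E x * (indicator (- E) (x - \<tau> - w) * indicator {-\<sigma>..\<sigma>} w) \<partial>lborel)
      \<le> ennreal \<eta> * indicator {-\<sigma>..\<sigma>} w" .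
  qed
  also have "\<dots> = ennreal \<eta> * ennreal (2 * \<sigma>)" using \<delta> by (simp add: nn_integral_cmult)
  finally have "(\<integral>\<^sup>+x. indicator E x * ennreal (1 - share E \<sigma> (x - \<tau>)) \<partial>lborel)
      \<le> ennreal (1 / (2 * \<sigma>)) * (ennreal \<eta> * ennreal (2 * \<sigma>))"
    by (simp add: mult_left_mono)
  also have "\<dots> = ennreal \<eta> * (ennreal (1 / (2 * \<sigma>)) * ennreal (2 * \<sigma>))" by (simp add: mult_ac)
  also have "ennreal (1 / (2 * \<sigma>)) * ennreal (2 * \<sigma>) = 1" using \<delta> by (simp add: ennreal_mult'[symmetric])
  finally show ?thesis by simp
qed

text \<open>Reduces a lower bound for an integral of a product to upper bounds for the integrals of
  the separate defects.\<close>

lemma one_le_prod_add_defects: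
  fixes a b c :: real
  assumes "0 \<le> a" "a \<le> 1" "0 \<le> b" "b \<le> 1" "0 \<le> c" "c \<le> 1"
  shows "1 \<le> a * b * c + (1 - a) + (1 - b) + (1 - c)"
proof -
  have "0 \<le> (1 - a) * (1 - b)" using assms by simp
  hence 1: "a + b - 1 \<le> a * b" by (simp add: algebra_simps)
  have "a * b \<le> 1" using assms by (simp add: mult_le_one)
  hence "0 \<le> (1 - a * b) * (1 - c)" using assms by simp
  hence "a * b + c - 1 \<le> a * b * c" by (simp add: algebra_simps)
  with 1 show ?thesis by linarith
qed

text \<open>Within distance \<sigma> of its centre the Gaussian is at least
  \<open>exp (- 1 / 2) / (\<sigma> * sqrt (2 * pi))\<close>, and the minorant gives \<open>E\<close>
  mass at least \<open>c * 2 * \<sigma>\<close> times the share there. The powers of \<sigma>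
  cancel, so the constant is independent of the scale.\<close>

lemma (in real_distribution) mollify_ge_share:
  assumes [measurable]: "E \<in> sets borel" and c: "0 < c"
    and minor: "\<And>S. S \<in> sets borel \<Longrightarrow> S \<subseteq> E \<Longrightarrow> ennreal c * emeasure lborel S \<le> emeasure M S"
    and \<sigma>: "0 < \<sigma>"
  shows "2 * c * exp (- 1 / 2) / sqrt (2 * pi) * share E \<sigma> x \<le> mollify M \<sigma> x"
proof -
  define S where "S = E \<inter> cball x \<sigma>"
  have [measurable]: "S \<in> sets borel" unfolding S_def by measurable
  have "ennreal (2 * \<sigma>) * ennreal (share E \<sigma> x) =
      (ennreal (2 * \<sigma>) * ennreal (1 / (2 * \<sigma>))) * (\<integral>\<^sup>+w. indicator E (x - w) * indicator {-\<sigma>..\<sigma>} w \<partial>lborel)"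
    by (simp only: ennreal_share assms mult.assoc)
  also have "ennreal (2 * \<sigma>) * ennreal (1 / (2 * \<sigma>)) = 1" using \<sigma> by (simp add: ennreal_mult'[symmetric])
  also have "1 * (\<integral>\<^sup>+w. indicator E (x - w) * indicator {-\<sigma>..\<sigma>} w \<partial>lborel) = (\<integral>\<^sup>+w. indicator S (x + (-1) * w) \<partial>lborel)"
    by (simp, intro nn_integral_cong) (auto simp: S_def indicator_def dist_real_def)
  also have "\<dots> = emeasure lborel S"
    using nn_integral_real_affine[of "indicator S" "-1" x] by simp
  finally have "ennreal c * (ennreal (2 * \<sigma>) * ennreal (share E \<sigma> x)) \<le> emeasure M S"
    using minor[of S] by (auto simp: S_def)
  hence "ennreal (c * (2 * \<sigma> * share E \<sigma> x)) \<le> ennreal (measure M S)"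
    using c \<sigma> by (simp add: ennreal_mult' emeasure_eq_measure)
  hence s: "c * (2 * \<sigma> * share E \<sigma> x) \<le> measure M S"
    by (subst (asm) ennreal_le_iff) auto
  define k where "k = exp (- 1 / 2) / (\<sigma> * sqrt (2 * pi))"
  have k: "0 < k" using \<sigma> by (simp add: k_def)
  have "2 * c * exp (- 1 / 2) / sqrt (2 * pi) * share E \<sigma> x = k * (c * (2 * \<sigma> * share E \<sigma> x))"
    using \<sigma> by (simp add: k_def)
  also have "\<dots> \<le> k * measure M S" using s k by (intro mult_left_mono) auto
  also have "\<dots> = (\<integral>y. k * indicator S y \<partial>M)" by simp
  also have "\<dots> \<le> (\<integral>y. normal_density y \<sigma> x \<partial>M)"
  proof (rule integral_mono)
    show "integrable M (\<lambda>y. k * indicator S y)" by (simp add: emeasure_eq_measure)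
    show "integrable M (\<lambda>y. normal_density y \<sigma> x)" by (rule integrable_normal_density_shift[OF \<sigma>])
    fix y
    show "k * indicator S y \<le> normal_density y \<sigma> x"
    proof (cases "y \<in> S")
      case True
      hence "\<bar>x - y\<bar> \<le> \<bar>\<sigma>\<bar>" using \<sigma> by (auto simp: S_def dist_real_def)
      hence "(x - y)\<^sup>2 \<le> \<sigma>\<^sup>2" by (simp add: abs_le_square_iff[symmetric])
      hence "- 1 / 2 \<le> - (x - y)\<^sup>2 / (2 * \<sigma>\<^sup>2)" using \<sigma> by (simp add: divide_le_eq)
      hence "exp (- 1 / 2) \<le> exp (- (x - y)\<^sup>2 / (2 * \<sigma>\<^sup>2))" by simp
      hence "exp (- 1 / 2) / (\<sigma> * sqrt (2 * pi)) \<le> exp (- (x - y)\<^sup>2 / (2 * \<sigma>\<^sup>2)) / (\<sigma> * sqrt (2 * pi))"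
        using \<sigma> by (intro divide_right_mono) auto
      also have "\<dots> = normal_density y \<sigma> x" using \<sigma> by (simp add: normal_density_def real_sqrt_mult mult.commute)
      finally show ?thesis using True by (simp add: k_def)
    qed (simp add: normal_density_nonneg)
  qed
  finally show ?thesis unfolding mollify_def .
qed

lemma std_normal_density_antimono:
  assumes "\<bar>x\<bar> \<le> R"
  shows "std_normal_density R \<le> std_normal_density x"
proof -
  have "x\<^sup>2 \<le> R\<^sup>2" using assms by (simp add: abs_le_square_iff[symmetric])
  thus ?thesis unfolding std_normal_density_def by (intro mult_left_mono) auto
qed

text \<open>Each of the three shares loses at most a sixth of the length of \<open>E\<close>, so
  half of it survives.\<close>

lemma nn_integral_share_product_ge:
  fixes E :: "real set"
  assumes E: "compact E" "E \<noteq> {}" and \<delta>: "0 < \<sigma>" "\<sigma> \<le> \<delta> / 2"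
    and m: "measure lborel {x. infdist x E \<le> \<delta>} \<le> measure lborel E + measure lborel E / 6"
    and \<tau>: "\<bar>\<tau>1\<bar> \<le> \<delta> / 2" "\<bar>\<tau>2\<bar> \<le> \<delta> / 2"
  shows "ennreal (measure lborel E / 2) \<le>
    (\<integral>\<^sup>+x. indicator E x * ennreal (share E \<sigma> x * share E \<sigma> (x - \<tau>1) * share E \<sigma> (x - \<tau>2)) \<partial>lborel)"
    (is "_ \<le> ?I")
proof -
  have [measurable]: "E \<in> sets borel" using E by (auto intro: borel_compact)
  let ?s = "share E \<sigma>"
  let ?J = "\<lambda>\<tau>. \<integral>\<^sup>+x. indicator E x * ennreal (1 - ?s (x - \<tau>)) \<partial>lborel"
  define l where "l = measure lborel E"
  have l: "0 \<le> l" by (simp add: l_def)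
  have J: "?J \<tau> \<le> ennreal (l / 6)" if "\<bar>\<tau>\<bar> \<le> \<delta> / 2" for \<tau>
    using nn_integral_share_compl_le[OF E that \<delta> m] by (simp add: l_def)
  have s: "0 \<le> ?s y" "?s y \<le> 1" for y using \<delta> by (auto intro: share_nonneg share_le_1)
  have "ennreal l = (\<integral>\<^sup>+x. indicator E x \<partial>lborel)"
    by (simp add: l_def emeasure_lborel_compact[OF E(1)])
  also have "\<dots> \<le> (\<integral>\<^sup>+x. indicator E x * ennreal (?s x * ?s (x - \<tau>1) * ?s (x - \<tau>2)) +
      indicator E x * ennreal (1 - ?s (x - 0)) + indicator E x * ennreal (1 - ?s (x - \<tau>1)) +
      indicator E x * ennreal (1 - ?s (x - \<tau>2)) \<partial>lborel)"
  proof (rule nn_integral_mono)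
    fix x
    have "1 \<le> ?s x * ?s (x - \<tau>1) * ?s (x - \<tau>2) + (1 - ?s (x - 0)) + (1 - ?s (x - \<tau>1)) + (1 - ?s (x - \<tau>2))"
      using one_le_prod_add_defects[OF s s s, of x "x - \<tau>1" "x - \<tau>2"] by simp
    hence "ennreal 1 \<le> ennreal (?s x * ?s (x - \<tau>1) * ?s (x - \<tau>2) + (1 - ?s (x - 0)) + (1 - ?s (x - \<tau>1)) + (1 - ?s (x - \<tau>2)))"
      by (rule ennreal_leI)
    also have "\<dots> = ennreal (?s x * ?s (x - \<tau>1) * ?s (x - \<tau>2)) + ennreal (1 - ?s (x - 0)) +
        ennreal (1 - ?s (x - \<tau>1)) + ennreal (1 - ?s (x - \<tau>2))"
    proof -
      have *: "ennreal (a + b + c + d) = ennreal a + ennreal b + ennreal c + ennreal d"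
        if "0 \<le> a" "0 \<le> b" "0 \<le> c" "0 \<le> d" for a b c d
        using that by (simp only: ennreal_plus add_nonneg_nonneg)
      thus ?thesis using s by (intro * mult_nonneg_nonneg) auto
    qed
    finally show "indicator E x \<le> indicator E x * ennreal (?s x * ?s (x - \<tau>1) * ?s (x - \<tau>2)) +
      indicator E x * ennreal (1 - ?s (x - 0)) + indicator E x * ennreal (1 - ?s (x - \<tau>1)) +
      indicator E x * ennreal (1 - ?s (x - \<tau>2))"
      by (cases "x \<in> E") auto
  qed
  also have "\<dots> = ?I + ?J 0 + ?J \<tau>1 + ?J \<tau>2"
    by (simp add: nn_integral_add del: diff_zero)
  also have "\<dots> \<le> ?I + ennreal (l / 6) + ennreal (l / 6) + ennreal (l / 6)"
    by (intro add_mono order_refl J \<tau>) (use \<delta> in auto)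
  also have "\<dots> = ?I + ennreal (l / 2)"
  proof -
    have "ennreal (l / 6) + ennreal (l / 6) + ennreal (l / 6) = ennreal (l / 6 + l / 6 + l / 6)"
      using l by (simp only: ennreal_plus add_nonneg_nonneg divide_nonneg_pos zero_less_numeral)
    also have "l / 6 + l / 6 + l / 6 = l / 2" by simp
    finally show ?thesis by (simp add: add.assoc)
  qed
  finally have "ennreal (l / 2 + l / 2) \<le> ?I + ennreal (l / 2)" by simp
  hence "ennreal (l / 2) + ennreal (l / 2) \<le> ennreal (l / 2) + ?I"
    using l by (subst (asm) ennreal_plus) (auto simp: add.commute)
  hence "ennreal (l / 2) \<le> ?I" by (simp only: ennreal_add_left_cancel_le) auto
  thus ?thesis by (simp add: l_def)
qed

text \<open>Only \<open>x\<close> in \<open>E\<close> and \<open>t\<close> between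
  \<open>\<tau> / 2\<close> and \<tau> are kept: such \<open>t\<close> are small enough for the
  translation estimates, yet far enough from 0 to keep \<open>1 - cos t\<close> above a positive
  constant. The resulting bound does not involve \<sigma>.\<close>

lemma (in real_distribution) config_mass_lower_bound:
  assumes C: "\<And>x r. 0 < r \<Longrightarrow> measure M (ball x r) \<le> C * r"
  obtains c0 \<sigma>1 where "0 < c0" "0 < \<sigma>1" "\<And>\<sigma>. 0 < \<sigma> \<Longrightarrow> \<sigma> \<le> \<sigma>1 \<Longrightarrow> c0 \<le> config_mass \<gamma>1 \<gamma>2 M \<sigma>"
proof -
  obtain E c where E: "compact E" and c: "0 < c" and lE: "0 < measure lborel E"
    and minor: "\<And>S. S \<in> sets borel \<Longrightarrow> S \<subseteq> E \<Longrightarrow> ennreal c * emeasure lborel S \<le> emeasure M S"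
    using lborel_minorant_on_compact[OF C] by blast
  have ne: "E \<noteq> {}" using lE by auto
  have [measurable]: "E \<in> sets borel" using E by (rule borel_compact)
  obtain R where R: "\<And>x. x \<in> E \<Longrightarrow> \<bar>x\<bar> \<le> R"
    using compact_imp_bounded[OF E] unfolding bounded_iff by auto
  obtain \<delta> where \<delta>: "0 < \<delta>"
      "measure lborel {x. infdist x E \<le> \<delta>} \<le> measure lborel E + measure lborel E / 6"
    using measure_thickening_le[OF E ne, of "measure lborel E / 6"] lE by auto
  \<comment> \<open>The second bound keeps both shifts below \<open>\<delta> / 2\<close>;
    \<open>\<tau> \<le> 1\<close> gives the bound \<open>std_normal_density 1\<close> for the weight
    in \<open>t\<close> and stays in the range where the cosine decreases.\<close>
  define \<tau> where "\<tau> = min 1 (\<delta> / (2 * (\<bar>\<gamma>1\<bar> + \<bar>\<gamma>2\<bar> + 1)))"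
  have \<tau>: "0 < \<tau>" "\<tau> \<le> 1" "\<tau> * (\<bar>\<gamma>1\<bar> + \<bar>\<gamma>2\<bar> + 1) \<le> \<delta> / 2"
  proof -
    have p: "0 < \<bar>\<gamma>1\<bar> + \<bar>\<gamma>2\<bar> + 1" by simp
    show "0 < \<tau>" using \<delta> p by (auto simp: \<tau>_def)
    show "\<tau> \<le> 1" by (simp add: \<tau>_def)
    have "\<tau> \<le> \<delta> / (2 * (\<bar>\<gamma>1\<bar> + \<bar>\<gamma>2\<bar> + 1))" by (simp add: \<tau>_def)
    thus "\<tau> * (\<bar>\<gamma>1\<bar> + \<bar>\<gamma>2\<bar> + 1) \<le> \<delta> / 2" using p by (simp add: pos_le_divide_eq mult_ac)
  qed
  define k where "k = 1 - cos (\<tau> / 2)"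
  have k: "0 < k" using cos_monotone_0_pi[of 0 "\<tau> / 2"] \<tau> pi_ge_two by (simp add: k_def)
  define c1 where "c1 = 2 * c * exp (- 1 / 2) / sqrt (2 * pi)"
  have c1: "0 < c1" using c by (simp add: c1_def)
  \<comment> \<open>Collects the lower bounds for the weight in \<open>t\<close>, the weight in
    \<open>x\<close>, the factor \<open>1 - cos t\<close> and the three mollified densities relative
    to their shares.\<close>
  define q where "q = std_normal_density 1 * (std_normal_density R * (k * (c1 * c1 * c1)))"
  have q: "0 < q" using k c1 by (simp add: q_def std_normal_density_def)
  define c0 where "c0 = \<tau> / 2 * (q * (measure lborel E / 2))"
  have c0: "0 < c0" using \<tau> q lE by (simp add: c0_def)
  have "c0 \<le> config_mass \<gamma>1 \<gamma>2 M \<sigma>" if \<sigma>: "0 < \<sigma>" "\<sigma> \<le> \<delta> / 2" for \<sigma>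
  proof -
    interpret N: prob_space std_normal_distribution by (rule prob_space_normal_density) simp
    interpret NN: pair_sigma_finite std_normal_distribution std_normal_distribution ..
    let ?f = "mollify M \<sigma>"
    let ?s = "share E \<sigma>"
    let ?F = "\<lambda>x t. (1 - cos t) * (?f x * ?f (x - \<gamma>1 * t) * ?f (x - \<gamma>2 * t))"
    let ?S = "\<lambda>x t. ?s x * ?s (x - \<gamma>1 * t) * ?s (x - \<gamma>2 * t)"
    have s0: "0 \<le> ?s y" for y using \<sigma> by (auto intro: share_nonneg)
    have fs: "c1 * ?s y \<le> ?f y" for y unfolding c1_def by (rule mollify_ge_share[OF _ c minor \<sigma>(1)]) auto
    have F0: "0 \<le> ?F x t" for x t
      using cos_le_one[of t] by (intro mult_nonneg_nonneg mollify_nonneg) auto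
    have "\<bar>1 - cos t\<bar> \<le> 2" for t :: real using cos_ge_minus_one[of t] cos_le_one[of t] by linarith
    hence i1: "integrable gauss_plane (\<lambda>z. ?F (fst z) (snd z))"
      by (intro integrable_config_mollify[OF \<sigma>(1), of "\<lambda>t. 1 - cos t" 2]) auto
    have pt: "indicator {\<tau> / 2..\<tau>} t * (ennreal q * (indicator E x * ennreal (?S x t))) \<le>
       ennreal (std_normal_density t) * (ennreal (std_normal_density x) * ennreal (?F x t))" for x t
    proof (cases "t \<in> {\<tau> / 2..\<tau>} \<and> x \<in> E")
      case True
      have "std_normal_density 1 \<le> std_normal_density t"
        using True \<tau> by (intro std_normal_density_antimono) auto
      moreover have "std_normal_density R \<le> std_normal_density x"
        using True R by (intro std_normal_density_antimono) auto
      moreover have "k \<le> 1 - cos t"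
        using True \<tau> pi_ge_two cos_monotone_0_pi_le[of "\<tau> / 2" t] by (auto simp: k_def)
      moreover have "(c1 * ?s x) * (c1 * ?s (x - \<gamma>1 * t)) * (c1 * ?s (x - \<gamma>2 * t)) \<le> ?f x * ?f (x - \<gamma>1 * t) * ?f (x - \<gamma>2 * t)"
        using c1 s0 by (intro mult_mono fs mult_nonneg_nonneg mollify_nonneg) auto
      ultimately have "std_normal_density 1 * (std_normal_density R * (k * ((c1 * ?s x) * (c1 * ?s (x - \<gamma>1 * t)) * (c1 * ?s (x - \<gamma>2 * t)))))
         \<le> std_normal_density t * (std_normal_density x * ?F x t)"
        using k c1 s0 cos_le_one[of t]
        by (intro mult_mono fs mult_nonneg_nonneg normal_density_nonneg mollify_nonneg) auto
      also have "std_normal_density 1 * (std_normal_density R * (k * ((c1 * ?s x) * (c1 * ?s (x - \<gamma>1 * t)) * (c1 * ?s (x - \<gamma>2 * t)))))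
        = q * ?S x t" by (simp add: q_def mult_ac)
      finally have "ennreal (q * ?S x t) \<le> ennreal (std_normal_density t * (std_normal_density x * ?F x t))"
        by (rule ennreal_leI)
      also have "\<dots> = ennreal (std_normal_density t) * (ennreal (std_normal_density x) * ennreal (?F x t))"
        by (simp only: ennreal_mult' normal_density_nonneg)
      finally show ?thesis using True q by (simp add: ennreal_mult')
    qed auto
    have inner: "indicator {\<tau> / 2..\<tau>} t * ennreal (q * (measure lborel E / 2)) \<le>
       (\<integral>\<^sup>+x. indicator {\<tau> / 2..\<tau>} t * (ennreal q * (indicator E x * ennreal (?S x t))) \<partial>lborel)" for t
    proof (cases "t \<in> {\<tau> / 2..\<tau>}")
      case True
      have "\<bar>g * t\<bar> \<le> \<delta> / 2" if "\<bar>g\<bar> \<le> \<bar>\<gamma>1\<bar> + \<bar>\<gamma>2\<bar> + 1" for g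
      proof -
        have "\<bar>g * t\<bar> = \<bar>t\<bar> * \<bar>g\<bar>" by (simp add: abs_mult mult.commute)
        also have "\<dots> \<le> \<tau> * (\<bar>\<gamma>1\<bar> + \<bar>\<gamma>2\<bar> + 1)" using True that \<tau> by (intro mult_mono) auto
        finally show ?thesis using \<tau> by linarith
      qed
      hence "ennreal (measure lborel E / 2) \<le> (\<integral>\<^sup>+x. indicator E x * ennreal (?S x t) \<partial>lborel)"
        by (intro nn_integral_share_product_ge[OF E ne \<sigma> \<delta>(2)]) auto
      hence "ennreal q * ennreal (measure lborel E / 2) \<le> ennreal q * (\<integral>\<^sup>+x. indicator E x * ennreal (?S x t) \<partial>lborel)"
        by (intro mult_left_mono) auto
      thus ?thesis using True q by (simp add: nn_integral_cmult ennreal_mult' del: times_divide_eq_right)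
    qed simp
    have "ennreal c0 = (\<integral>\<^sup>+t. ennreal (q * (measure lborel E / 2)) * indicator {\<tau> / 2..\<tau>} t \<partial>lborel)"
    proof (subst nn_integral_cmult_indicator)
      have "emeasure lborel {\<tau> / 2..\<tau>} = ennreal (\<tau> / 2)" using \<tau> by simp
      moreover have "0 \<le> q * (measure lborel E / 2)" using q lE by simp
      moreover have "c0 = q * (measure lborel E / 2) * (\<tau> / 2)" by (simp add: c0_def)
      ultimately show "ennreal c0 = ennreal (q * (measure lborel E / 2)) * emeasure lborel {\<tau> / 2..\<tau>}"
        by (simp only: ennreal_mult')
    qed simp
    also have "\<dots> \<le> (\<integral>\<^sup>+t. \<integral>\<^sup>+x. indicator {\<tau> / 2..\<tau>} t * (ennreal q * (indicator E x * ennreal (?S x t))) \<partial>lborel \<partial>lborel)"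
      using inner by (intro nn_integral_mono) (simp add: mult.commute)
    also have "\<dots> \<le> (\<integral>\<^sup>+t. \<integral>\<^sup>+x. ennreal (std_normal_density t) * (ennreal (std_normal_density x) * ennreal (?F x t)) \<partial>lborel \<partial>lborel)"
      by (intro nn_integral_mono pt)
    also have "\<dots> = (\<integral>\<^sup>+t. \<integral>\<^sup>+x. ennreal (?F x t) \<partial>std_normal_distribution \<partial>std_normal_distribution)"
      by (simp add: nn_integral_density nn_integral_cmult)
    also have "\<dots> = (\<integral>\<^sup>+z. ennreal (?F (fst z) (snd z)) \<partial>gauss_plane)"
      by (subst NN.nn_integral_snd[symmetric]) auto
    also have "\<dots> = ennreal (config_mass \<gamma>1 \<gamma>2 M \<sigma>)"
      unfolding config_mass_def by (intro nn_integral_eq_integral i1 AE_I2 F0)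
    finally show ?thesis
      using c0 by (subst (asm) ennreal_le_iff2) auto
  qed
  thus ?thesis using that[OF c0, of "\<delta> / 2"] \<delta> by auto
qed

subsection \<open>The compactness argument\<close>

text \<open>Frequencies with \<open>\<bar>\<xi>\<bar> \<le> 1\<close> are handled by the trivial
  bound 1 for the transform and contribute the length 2; the rest is controlled by the energy
  integral. Of the two factors 2 pi, one is the Jacobian of \<open>a = - (2 * pi * \<xi>)\<close>
  and the other bounds the weight. The conditions on \<open>w\<close> fit both the constant 1 and
  \<open>\<bar>a\<bar> powr \<kappa>\<close>.\<close>

lemma (in real_distribution) nn_integral_char_weighted_le:
  assumes w: "\<And>\<xi>. 0 \<le> w (- (2 * pi * \<xi>))" "\<And>\<xi>. w (- (2 * pi * \<xi>)) \<le> 2 * pi * max 1 (\<bar>\<xi>\<bar> powr p)"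
      "\<And>\<xi>. \<bar>\<xi>\<bar> \<le> 1 \<Longrightarrow> w (- (2 * pi * \<xi>)) \<le> 2 * pi"
    and [measurable]: "w \<in> borel_measurable borel" and I: "0 \<le> I"
    and int: "(\<integral>\<^sup>+\<xi>. ennreal (cmod (fourier_measure M \<xi>) ^ 3 * \<bar>\<xi>\<bar> powr p) \<partial>lborel) \<le> ennreal I"
    and p: "0 < p"
  shows "(\<integral>\<^sup>+a. ennreal (cmod (char M a) ^ 3 * w a) \<partial>lborel) \<le> ennreal (4 * pi\<^sup>2 * (2 + I))"
proof -
  have [measurable]: "fourier_measure M \<in> borel_measurable borel"
    unfolding fourier_measure_def[abs_def] by measurable
  let ?\<phi> = "\<lambda>\<xi>. cmod (fourier_measure M \<xi>)"
  have "(\<integral>\<^sup>+a. ennreal (cmod (char M a) ^ 3 * w a) \<partial>lborel) =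
      ennreal (2 * pi) * (\<integral>\<^sup>+\<xi>. ennreal (?\<phi> \<xi> ^ 3 * w (- (2 * pi * \<xi>))) \<partial>lborel)"
    by (subst nn_integral_real_affine[where c="- (2 * pi)" and t=0]) (auto simp: fourier_measure_def)
  also have "\<dots> \<le> ennreal (2 * pi) * (\<integral>\<^sup>+\<xi>. ennreal (2 * pi) *
      (indicator {-1..1} \<xi> + ennreal (?\<phi> \<xi> ^ 3 * \<bar>\<xi>\<bar> powr p)) \<partial>lborel)"
  proof (intro mult_left_mono nn_integral_mono)
    fix \<xi> :: real
    have \<phi>: "?\<phi> \<xi> ^ 3 \<le> 1" unfolding fourier_measure_def by (intro power_le_one cmod_char_le_1) simp
    show "ennreal (?\<phi> \<xi> ^ 3 * w (- (2 * pi * \<xi>))) \<le>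
       ennreal (2 * pi) * (indicator {-1..1} \<xi> + ennreal (?\<phi> \<xi> ^ 3 * \<bar>\<xi>\<bar> powr p))"
    proof (cases "\<bar>\<xi>\<bar> \<le> 1")
      case True
      have "?\<phi> \<xi> ^ 3 * w (- (2 * pi * \<xi>)) \<le> 1 * (2 * pi)" by (intro mult_mono \<phi> w True) auto
      hence "ennreal (?\<phi> \<xi> ^ 3 * w (- (2 * pi * \<xi>))) \<le> ennreal (2 * pi) * 1"
        by (simp add: ennreal_leI)
      also have "\<dots> \<le> ennreal (2 * pi) * (indicator {-1..1} \<xi> + ennreal (?\<phi> \<xi> ^ 3 * \<bar>\<xi>\<bar> powr p))"
        using True by (intro mult_left_mono) (auto simp: indicator_def abs_le_iff)
      finally show ?thesis .
    next
      case False
      hence "max 1 (\<bar>\<xi>\<bar> powr p) = \<bar>\<xi>\<bar> powr p" using p by (intro max.absorb2 ge_one_powr_ge_zero) auto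
      hence "?\<phi> \<xi> ^ 3 * w (- (2 * pi * \<xi>)) \<le> ?\<phi> \<xi> ^ 3 * (2 * pi * \<bar>\<xi>\<bar> powr p)"
        using w(2)[of \<xi>] by (intro mult_left_mono) auto
      hence "ennreal (?\<phi> \<xi> ^ 3 * w (- (2 * pi * \<xi>))) \<le> ennreal (2 * pi) * ennreal (?\<phi> \<xi> ^ 3 * \<bar>\<xi>\<bar> powr p)"
        by (simp add: ennreal_mult'[symmetric] ennreal_leI mult_ac)
      thus ?thesis using False by (auto simp: indicator_def)
    qed
  qed simp
  also have "(\<integral>\<^sup>+\<xi>. ennreal (2 * pi) * (indicator {-1..1} \<xi> + ennreal (?\<phi> \<xi> ^ 3 * \<bar>\<xi>\<bar> powr p)) \<partial>lborel) =
     ennreal (2 * pi) * (2 + (\<integral>\<^sup>+\<xi>. ennreal (?\<phi> \<xi> ^ 3 * \<bar>\<xi>\<bar> powr p) \<partial>lborel))"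
    by (simp add: nn_integral_cmult nn_integral_add)
  also have "ennreal (2 * pi) * \<dots> \<le> ennreal (2 * pi) * (ennreal (2 * pi) * (2 + ennreal I))"
    by (intro mult_left_mono add_left_mono int) auto
  also have "2 + ennreal I = ennreal (2 + I)" using I by simp
  also have "ennreal (2 * pi) * (ennreal (2 * pi) * ennreal (2 + I)) = ennreal (4 * pi\<^sup>2 * (2 + I))"
    by (simp only: ennreal_mult'[symmetric] mult_nonneg_nonneg pi_ge_zero zero_le_numeral)
       (simp add: power2_eq_square mult_ac)
  finally show ?thesis .
qed

text \<open>At parameter 2/3 the energy integrand is a cube times the frequency to the power
  \<open>3 * s / 2 - 1\<close>, positive precisely when \<open>s > 2 / 3\<close>. The power 3/2 of
  \<open>K\<close> undoes the outer exponent, and \<kappa> is capped at 1 as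
  \<open>gauss_diff_cube_le\<close> demands.\<close>

lemma (in real_distribution) char_bounds_of_energy:
  assumes s: "2 / 3 < s" and K: "0 < K" and en: "energy s (2 / 3) M = ennreal K"
  defines "\<kappa> \<equiv> min 1 (3 * s / 2 - 1)" and "B \<equiv> 4 * pi\<^sup>2 * (2 + K powr (3 / 2))"
  shows "cube_int (char M) \<le> ennreal B"
    and "(\<integral>\<^sup>+a. ennreal (cmod (char M a) ^ 3 * \<bar>a\<bar> powr \<kappa>) \<partial>lborel) \<le> ennreal B"
proof -
  define p where "p = 3 * s / 2 - 1"
  have p: "0 < p" using s by (simp add: p_def)
  have \<kappa>: "0 < \<kappa>" "\<kappa> \<le> 1" "\<kappa> \<le> p" using p by (auto simp: \<kappa>_def p_def)
  define I where "I = (\<integral>\<^sup>+\<xi>. ennreal (cmod (fourier_measure M \<xi>) ^ 3 * \<bar>\<xi>\<bar> powr p) \<partial>lborel)"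
  have "cmod z powr 3 = cmod z ^ 3" for z by (cases "z = 0") (auto simp: powr_numeral)
  hence rp: "ennreal_rpow I (2 / 3) = ennreal K"
    using en by (simp add: energy_def I_def p_def mult.commute[of s])
  \<comment> \<open>An infinite integral would make the energy \<top>, which differs from
    \<open>ennreal K\<close>; this makes \<open>enn2real I\<close> meaningful.\<close>
  hence fin: "I \<noteq> \<top>" by (auto simp: ennreal_rpow_def)
  hence "enn2real I powr (2 / 3) = K" using rp K by (simp add: ennreal_rpow_def)
  hence "K powr (3 / 2) = enn2real I" using K by (auto simp: powr_powr)
  hence I: "I \<le> ennreal (K powr (3 / 2))" using fin ennreal_enn2real[of I] by (simp only: less_top)
  have pi2: "1 \<le> 2 * pi" using pi_ge_two by simp
  show "cube_int (char M) \<le> ennreal B"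
  proof -
    have "1 * 1 \<le> 2 * pi * max 1 (\<bar>\<xi>\<bar> powr p)" for \<xi> :: real
      using pi2 by (intro mult_mono) auto
    hence "(\<integral>\<^sup>+a. ennreal (cmod (char M a) ^ 3 * 1) \<partial>lborel) \<le> ennreal B"
      unfolding B_def
      by (intro nn_integral_char_weighted_le[of "\<lambda>_. 1" p]) (use I p pi2 in \<open>simp_all add: I_def\<close>)
    thus ?thesis by (simp add: cube_int_def)
  qed
  show "(\<integral>\<^sup>+a. ennreal (cmod (char M a) ^ 3 * \<bar>a\<bar> powr \<kappa>) \<partial>lborel) \<le> ennreal B"
    unfolding B_def
  proof (rule nn_integral_char_weighted_le[of _ p])
    fix \<xi> :: real
    have "(2 * pi) powr \<kappa> \<le> (2 * pi) powr 1" using \<kappa> pi2 by (intro powr_mono) auto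
    hence a: "(2 * pi) powr \<kappa> \<le> 2 * pi" by simp
    have b: "\<bar>- (2 * pi * \<xi>)\<bar> powr \<kappa> = (2 * pi) powr \<kappa> * \<bar>\<xi>\<bar> powr \<kappa>"
      by (simp add: abs_mult powr_mult)
    have 1: "\<bar>\<xi>\<bar> powr \<kappa> \<le> 1" if "\<bar>\<xi>\<bar> \<le> 1"
      using that \<kappa> by (intro powr_le1) auto
    have "\<bar>\<xi>\<bar> powr \<kappa> \<le> max 1 (\<bar>\<xi>\<bar> powr p)"
    proof (cases "\<bar>\<xi>\<bar> \<le> 1")
      case False
      hence "\<bar>\<xi>\<bar> powr \<kappa> \<le> \<bar>\<xi>\<bar> powr p" using \<kappa> by (intro powr_mono) auto
      thus ?thesis by simp
    qed (use 1 in auto)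
    thus "\<bar>- (2 * pi * \<xi>)\<bar> powr \<kappa> \<le> 2 * pi * max 1 (\<bar>\<xi>\<bar> powr p)"
      unfolding b by (intro mult_mono a) auto
    show "\<bar>- (2 * pi * \<xi>)\<bar> powr \<kappa> \<le> 2 * pi" if "\<bar>\<xi>\<bar> \<le> 1"
      unfolding b using mult_mono[OF a 1[OF that]] by simp
  qed (use I p in \<open>simp_all add: I_def\<close>)
qed

text \<open>Weak convergence tests continuous functions only, so the ball is replaced by a tent that
  is 1 on it and 0 outside the ball of twice the radius. The doubled radius is the source of the
  factor 2.\<close>

lemma weak_limit_ball_bound:
  assumes M: "\<And>n. real_distribution (M n)" "real_distribution N" "weak_conv_m M N"
    and ball: "\<And>n x r. 0 < r \<Longrightarrow> measure (M n) (ball x r) \<le> C * r powr (1 - \<epsilon> n)"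
    and \<epsilon>: "\<epsilon> \<longlonglongrightarrow> 0" and r: "0 < r"
  shows "measure N (ball x r) \<le> 2 * C * r"
proof -
  interpret N: real_distribution N by fact
  interpret M: real_distribution "M n" for n by fact
  define \<phi> where "\<phi> y = max 0 (min 1 (2 - \<bar>x - y\<bar> / r))" for y
  have \<phi>: "0 \<le> \<phi> y" "\<phi> y \<le> 1" for y by (auto simp: \<phi>_def)
  have cont: "isCont \<phi> y" for y unfolding \<phi>_def using r by (intro continuous_intros) auto
  hence [measurable]: "\<phi> \<in> borel_measurable borel"
    by (intro borel_measurable_continuous_onI continuous_at_imp_continuous_on) auto
  have "measure N (ball x r) = (\<integral>y. indicator (ball x r) y \<partial>N)" by simp
  also have "\<dots> \<le> (\<integral>y. \<phi> y \<partial>N)"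
  proof (rule integral_mono)
    show "integrable N \<phi>" by (rule N.integrable_const_bound[where B=1]) (use \<phi> in auto)
    show "integrable N (indicator (ball x r) :: real \<Rightarrow> real)" by (simp add: N.emeasure_eq_measure)
    show "indicator (ball x r) y \<le> \<phi> y" for y
      using r by (auto simp: \<phi>_def indicator_def dist_real_def)
  qed
  finally have 1: "measure N (ball x r) \<le> (\<integral>y. \<phi> y \<partial>N)" .
  have lim: "(\<lambda>n. \<integral>y. \<phi> y \<partial>M n) \<longlonglongrightarrow> (\<integral>y. \<phi> y \<partial>N)"
    by (rule weak_conv_imp_integral_bdd_continuous_conv[OF M, where B=1]) (use \<phi> cont in auto)
  have lim2: "(\<lambda>n. C * (2 * r) powr (1 - \<epsilon> n)) \<longlonglongrightarrow> C * (2 * r) powr (1 - 0)"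
    using r by (intro tendsto_intros \<epsilon>) auto
  have "(\<integral>y. \<phi> y \<partial>M n) \<le> C * (2 * r) powr (1 - \<epsilon> n)" for n
  proof -
    have "(\<integral>y. \<phi> y \<partial>M n) \<le> (\<integral>y. indicator (ball x (2 * r)) y \<partial>M n)"
    proof (rule integral_mono)
      show "integrable (M n) \<phi>" by (rule M.integrable_const_bound[where B=1]) (use \<phi> in auto)
      show "integrable (M n) (indicator (ball x (2 * r)) :: real \<Rightarrow> real)" by (simp add: M.emeasure_eq_measure)
      show "\<phi> y \<le> indicator (ball x (2 * r)) y" for y
        using r by (auto simp: \<phi>_def indicator_def dist_real_def field_simps)
    qed
    also have "\<dots> = measure (M n) (ball x (2 * r))" by simp
    also have "\<dots> \<le> C * (2 * r) powr (1 - \<epsilon> n)" using r by (intro ball) auto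
    finally show ?thesis .
  qed
  hence "(\<integral>y. \<phi> y \<partial>N) \<le> C * (2 * r) powr (1 - 0)" by (intro LIMSEQ_le[OF lim lim2]) auto
  with 1 r show ?thesis by (simp add: mult_ac)
qed

lemma (in real_distribution) config_mass_diff_le:
  assumes \<gamma>: "\<gamma>1 \<noteq> 0" "\<gamma>2 \<noteq> 0" "\<gamma>1 \<noteq> \<gamma>2" and \<kappa>: "0 < \<kappa>" "\<kappa> \<le> 1" and B: "0 \<le> B"
    and cube: "cube_int (char M) \<le> ennreal B"
    and wcube: "(\<integral>\<^sup>+a. ennreal (cmod (char M a) ^ 3 * \<bar>a\<bar> powr \<kappa>) \<partial>lborel) \<le> ennreal B"
    and \<sigma>: "0 < \<sigma>" "\<sigma> \<le> \<sigma>0" "0 < \<sigma>'" "\<sigma>' \<le> \<sigma>0" and k: "0 < k"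
  shows "config_mass \<gamma>1 \<gamma>2 M \<sigma> - config_mass \<gamma>1 \<gamma>2 M \<sigma>' \<le>
    2 * (3 * config_const \<gamma>1 \<gamma>2 * B * (k ^ 6 * \<sigma>0 powr \<kappa> + 2 / k ^ 3))"
proof -
  define T where "T \<theta> \<sigma> = config_form \<gamma>1 \<gamma>2 \<theta> (\<lambda>x. mollify M \<sigma> x) (\<lambda>x. mollify M \<sigma> x) (\<lambda>x. mollify M \<sigma> x)" for \<theta> \<sigma>
  have T: "cmod (T \<theta> \<sigma> - T \<theta> \<sigma>') \<le> 3 * config_const \<gamma>1 \<gamma>2 * B * (k ^ 6 * \<sigma>0 powr \<kappa> + 2 / k ^ 3)" for \<theta>
    unfolding T_def by (rule config_form_mollify_diff[OF \<gamma> \<kappa> B cube wcube \<sigma> k])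
  have "config_mass \<gamma>1 \<gamma>2 M \<sigma> - config_mass \<gamma>1 \<gamma>2 M \<sigma>' = Re (T 0 \<sigma> - T 0 \<sigma>') - Re (T 1 \<sigma> - T 1 \<sigma>')"
    using \<sigma> by (simp add: config_mass_eq_config_form T_def)
  also have "\<dots> \<le> cmod (T 0 \<sigma> - T 0 \<sigma>') + cmod (T 1 \<sigma> - T 1 \<sigma>')"
    using abs_Re_le_cmod[of "T 0 \<sigma> - T 0 \<sigma>'"] abs_Re_le_cmod[of "T 1 \<sigma> - T 1 \<sigma>'"] by linarith
  also have "\<dots> \<le> 3 * config_const \<gamma>1 \<gamma>2 * B * (k ^ 6 * \<sigma>0 powr \<kappa> + 2 / k ^ 3) +
      3 * config_const \<gamma>1 \<gamma>2 * B * (k ^ 6 * \<sigma>0 powr \<kappa> + 2 / k ^ 3)"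
    by (intro add_mono T)
  finally show ?thesis by (simp only: mult_2)
qed

lemma tight_unit_interval:
  assumes M: "\<And>n. real_distribution (M n)" and supp: "\<And>n. measure_support (M n) \<subseteq> {0..1}"
  shows "tight M"
  unfolding tight_def
proof (intro conjI allI impI M)
  fix e :: real assume e: "0 < e"
  \<comment> \<open>\<open>tight\<close> uses intervals open on the left, so the left end moves to
    -1 in order not to lose a possible atom at 0.\<close>
  have "measure (M n) {-1<..1} = 1" for n
  proof -
    interpret M: real_distribution "M n" by fact
    show ?thesis
      using M.AE_in_closed_support[OF supp] by (intro M.prob_eq_1[THEN iffD2]) auto
  qed
  thus "\<exists>a b. a < b \<and> (\<forall>n. 1 - e < measure (M n) {a<..b})" using e by (intro exI[of _ "-1"] exI[of _ 1]) auto
qed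

text \<open>The energy enters through \<open>B\<close> and \<kappa> alone. Counterexamples are
  collected at the thresholds \<open>1 / Suc n\<close>, so the existence of
  \<open>\<epsilon>_star\<close> is proved by contradiction and no value for it results.\<close>

lemma config_of_energy_bound:
  assumes \<gamma>: "\<gamma>1 \<noteq> 0" "\<gamma>2 \<noteq> 0" "\<gamma>1 \<noteq> \<gamma>2" and \<kappa>: "0 < \<kappa>" "\<kappa> \<le> 1" and B: "0 \<le> B"
  obtains \<epsilon>_star :: real where "0 < \<epsilon>_star"
    "\<And>A M \<epsilon>0. compact A \<Longrightarrow> A \<subseteq> {0..1} \<Longrightarrow> supports A M \<Longrightarrow> cube_int (char M) \<le> ennreal B \<Longrightarrow>
       (\<integral>\<^sup>+a. ennreal (cmod (char M a) ^ 3 * \<bar>a\<bar> powr \<kappa>) \<partial>lborel) \<le> ennreal B \<Longrightarrow>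
       0 < \<epsilon>0 \<Longrightarrow> \<epsilon>0 \<le> \<epsilon>_star \<Longrightarrow> (\<And>x r. 0 < r \<Longrightarrow> measure M (ball x r) \<le> C * r powr (1 - \<epsilon>0)) \<Longrightarrow>
       \<exists>x t. t \<noteq> 0 \<and> {x, x - \<gamma>1 * t, x - \<gamma>2 * t} \<subseteq> A"
proof (rule ccontr)
  define bad where "bad A M \<epsilon>0 \<longleftrightarrow> compact A \<and> A \<subseteq> {0..1} \<and> supports A M \<and> cube_int (char M) \<le> ennreal B \<and>
       (\<integral>\<^sup>+a. ennreal (cmod (char M a) ^ 3 * \<bar>a\<bar> powr \<kappa>) \<partial>lborel) \<le> ennreal B \<and>
       0 < \<epsilon>0 \<and> (\<forall>x r. 0 < r \<longrightarrow> measure M (ball x r) \<le> C * r powr (1 - \<epsilon>0)) \<and>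
       \<not> (\<exists>x t. t \<noteq> 0 \<and> {x, x - \<gamma>1 * t, x - \<gamma>2 * t} \<subseteq> A)" for A M \<epsilon>0
  note obt = that
  assume contra: "\<not> thesis"
  have "\<exists>A M \<epsilon>0. \<epsilon>0 \<le> 1 / Suc n \<and> bad A M \<epsilon>0" for n
  proof (rule ccontr)
    assume none: "\<nexists>A M \<epsilon>0. \<epsilon>0 \<le> 1 / Suc n \<and> bad A M \<epsilon>0"
    have thesis
    proof (rule obt[of "1 / Suc n"])
      fix A M and \<epsilon>0 :: real
      assume "compact A" "A \<subseteq> {0..1}" "supports A M" "cube_int (char M) \<le> ennreal B"
       "(\<integral>\<^sup>+a. ennreal (cmod (char M a) ^ 3 * \<bar>a\<bar> powr \<kappa>) \<partial>lborel) \<le> ennreal B"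
       "0 < \<epsilon>0" "\<epsilon>0 \<le> 1 / Suc n" "\<And>x r. 0 < r \<Longrightarrow> measure M (ball x r) \<le> C * r powr (1 - \<epsilon>0)"
      moreover have "\<not> bad A M \<epsilon>0" using none \<open>\<epsilon>0 \<le> 1 / Suc n\<close> by blast
      ultimately show "\<exists>x t. t \<noteq> 0 \<and> {x, x - \<gamma>1 * t, x - \<gamma>2 * t} \<subseteq> A" unfolding bad_def by blast
    qed simp
    with contra show False by blast
  qed
  then obtain A M e where e: "\<And>n. e n \<le> 1 / Suc n" and bad: "\<And>n. bad (A n) (M n) (e n)" by metis
  have rd: "real_distribution (M n)" and supp: "measure_support (M n) \<subseteq> A n" for n
    using bad[of n] by (auto simp: bad_def supports_def)
  have "measure_support (M n) \<subseteq> {0..1}" for n using supp[of n] bad[of n] by (auto simp: bad_def)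
  hence "tight M" by (intro tight_unit_interval rd)
  from tight_imp_convergent_subsubsequence[OF this strict_mono_id]
  obtain r N where r: "strict_mono (r :: nat \<Rightarrow> nat)" and N: "real_distribution N" "weak_conv_m (M \<circ> r) N" by auto
  interpret N: real_distribution N by fact
  have rd': "real_distribution ((M \<circ> r) n)" for n using rd by simp
  have "e \<longlonglongrightarrow> 0"
  proof (rule tendsto_sandwich[of "\<lambda>_. 0" e _ "\<lambda>n. 1 / Suc n"])
    show "\<forall>\<^sub>F n in sequentially. 0 \<le> e n" using bad by (auto simp: bad_def less_imp_le)
    show "\<forall>\<^sub>F n in sequentially. e n \<le> 1 / Suc n" using e by auto
    show "(\<lambda>n. 1 / real (Suc n)) \<longlonglongrightarrow> 0" using LIMSEQ_inverse_real_of_nat by (simp add: inverse_eq_divide)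
  qed simp
  hence e0: "(\<lambda>n. e (r n)) \<longlonglongrightarrow> 0" using LIMSEQ_subseq_LIMSEQ[OF _ r, of e 0] by (simp add: o_def)
  have "measure N (ball x \<rho>) \<le> (2 * C) * \<rho>" if "0 < \<rho>" for x \<rho>
    by (rule weak_limit_ball_bound[OF rd' N _ e0 that]) (use bad in \<open>auto simp: bad_def\<close>)
  then obtain c0 \<sigma>1 where c0: "0 < c0" "0 < \<sigma>1"
    "\<And>\<sigma>. 0 < \<sigma> \<Longrightarrow> \<sigma> \<le> \<sigma>1 \<Longrightarrow> c0 \<le> config_mass \<gamma>1 \<gamma>2 N \<sigma>"
    using N.config_mass_lower_bound by blast
  define L where "L = 3 * config_const \<gamma>1 \<gamma>2 * B"
  have "0 \<le> L" using B config_const_nonneg by (simp add: L_def)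
  then obtain \<sigma>0 k where \<sigma>0: "0 < \<sigma>0" "0 < k" "L * (k ^ 6 * \<sigma>0 powr \<kappa> + 2 / k ^ 3) \<le> c0 / 4"
    using uniform_cauchy_parameter[of L \<kappa> "c0 / 4"] \<kappa> c0 by auto
  \<comment> \<open>The common scale: below \<sigma>0 for the uniform comparison, below \<sigma>1
    for the lower bound on \<open>N\<close>, and chosen before \<open>n\<close>.\<close>
  define \<sigma> where "\<sigma> = min \<sigma>0 \<sigma>1"
  have \<sigma>: "0 < \<sigma>" "\<sigma> \<le> \<sigma>0" "\<sigma> \<le> \<sigma>1" using \<sigma>0 c0 by (auto simp: \<sigma>_def)
  \<comment> \<open>Of the three quarters of \<open>c0\<close>, one comes from the small scale
    \<sigma>', which may depend on \<open>n\<close>, and two from the comparison of \<sigma> with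
    \<sigma>', one for each of the two forms behind \<open>config_mass\<close>.\<close>
  have small: "config_mass \<gamma>1 \<gamma>2 (M n) \<sigma> \<le> 3 * c0 / 4" for n
  proof -
    interpret M: real_distribution "M n" by (rule rd)
    have b: "compact (A n)" "cube_int (char (M n)) \<le> ennreal B"
      "(\<integral>\<^sup>+a. ennreal (cmod (char (M n) a) ^ 3 * \<bar>a\<bar> powr \<kappa>) \<partial>lborel) \<le> ennreal B"
      "\<And>x t. t \<noteq> 0 \<Longrightarrow> \<not> {x, x - \<gamma>1 * t, x - \<gamma>2 * t} \<subseteq> A n"
      using bad[of n] unfolding bad_def by blast+
    obtain \<sigma>2 where \<sigma>2: "0 < \<sigma>2" "\<And>\<sigma>. 0 < \<sigma> \<Longrightarrow> \<sigma> \<le> \<sigma>2 \<Longrightarrow> config_mass \<gamma>1 \<gamma>2 (M n) \<sigma> \<le> c0 / 4"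
      using M.config_mass_small_if_no_config[OF \<gamma> B b(2) b(1) supp b(4), of "c0 / 4"] c0(1) by auto
    define \<sigma>' where "\<sigma>' = min \<sigma>0 \<sigma>2"
    have \<sigma>': "0 < \<sigma>'" "\<sigma>' \<le> \<sigma>0" "\<sigma>' \<le> \<sigma>2" using \<sigma>0 \<sigma>2 by (auto simp: \<sigma>'_def)
    have "config_mass \<gamma>1 \<gamma>2 (M n) \<sigma> - config_mass \<gamma>1 \<gamma>2 (M n) \<sigma>' \<le> 2 * (L * (k ^ 6 * \<sigma>0 powr \<kappa> + 2 / k ^ 3))"
      unfolding L_def by (rule M.config_mass_diff_le[OF \<gamma> \<kappa> B b(2,3) \<sigma>(1,2) \<sigma>'(1,2) \<sigma>0(2)])
    with \<sigma>0(3) \<sigma>2(2)[OF \<sigma>'(1,3)] show ?thesis by linarith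
  qed
  have "(\<lambda>n. config_mass \<gamma>1 \<gamma>2 ((M \<circ> r) n) \<sigma>) \<longlonglongrightarrow> config_mass \<gamma>1 \<gamma>2 N \<sigma>"
    by (rule weak_conv_config_mass[OF rd' N \<sigma>(1)])
  hence "config_mass \<gamma>1 \<gamma>2 N \<sigma> \<le> 3 * c0 / 4"
    by (rule LIMSEQ_le_const2) (use small in auto)
  with c0(3)[OF \<sigma>(1,3)] c0(1) show False by linarith
qed

theorem corollary1p12:
  fixes \<gamma>1 \<gamma>2 s C K :: real
  assumes "\<gamma>1 \<in> \<rat>" and "\<gamma>1 \<noteq> 0"
    and "\<gamma>2 \<in> \<rat>" and "\<gamma>2 \<noteq> 0"
    and "s > 2 / 3" and "C > 0" and "K > 0"
  shows "\<exists>\<epsilon>_star > 0. \<forall>(A :: real set) (\<mu> :: real measure).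
           A \<subseteq> {0..1} \<longrightarrow> compact A \<longrightarrow> supports A \<mu> \<longrightarrow>
           energy s (2 / 3) \<mu> = ennreal K \<longrightarrow>
           (\<exists>\<epsilon>0. 0 < \<epsilon>0 \<and> \<epsilon>0 \<le> \<epsilon>_star \<and>
              (\<forall>x. \<forall>r > 0. measure \<mu> (ball x r) \<le> C * r powr (1 - \<epsilon>0))) \<longrightarrow>
           (\<exists>x t :: real. t \<noteq> 0 \<and> {x, x - \<gamma>1 * t, x - \<gamma>2 * t} \<subseteq> A)"
proof -
  \<comment> \<open>If the two ratios coincide, a three-point configuration with ratios \<open>\<gamma>1\<close> and \<open>2 * \<gamma>1\<close> contains the required one.\<close>
  define \<gamma> where "\<gamma> = (if \<gamma>1 = \<gamma>2 then 2 * \<gamma>1 else \<gamma>2)"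
  have \<gamma>: "\<gamma>1 \<noteq> 0" "\<gamma> \<noteq> 0" "\<gamma>1 \<noteq> \<gamma>" using assms by (auto simp: \<gamma>_def)
  define \<kappa> where "\<kappa> = min 1 (3 * s / 2 - 1)"
  have \<kappa>: "0 < \<kappa>" "\<kappa> \<le> 1" using assms by (auto simp: \<kappa>_def)
  define B where "B = 4 * pi\<^sup>2 * (2 + K powr (3 / 2))"
  have B: "0 \<le> B" by (simp add: B_def)
  \<comment> \<open>The threshold is fixed before the set and the measure; \<open>B\<close> and
    \<kappa> depend only on \<open>K\<close> and \<open>s\<close>.\<close>
  obtain \<epsilon>_star :: real where star: "0 < \<epsilon>_star"
    "\<And>A M \<epsilon>0. compact A \<Longrightarrow> A \<subseteq> {0..1} \<Longrightarrow> supports A M \<Longrightarrow> cube_int (char M) \<le> ennreal B \<Longrightarrow>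
       (\<integral>\<^sup>+a. ennreal (cmod (char M a) ^ 3 * \<bar>a\<bar> powr \<kappa>) \<partial>lborel) \<le> ennreal B \<Longrightarrow>
       0 < \<epsilon>0 \<Longrightarrow> \<epsilon>0 \<le> \<epsilon>_star \<Longrightarrow> (\<And>x r. 0 < r \<Longrightarrow> measure M (ball x r) \<le> C * r powr (1 - \<epsilon>0)) \<Longrightarrow>
       \<exists>x t. t \<noteq> 0 \<and> {x, x - \<gamma>1 * t, x - \<gamma> * t} \<subseteq> A"
    using config_of_energy_bound[OF \<gamma> \<kappa> B, where C=C] by blast
  show ?thesis
  proof (rule exI[of _ \<epsilon>_star], intro conjI star(1) allI impI)
    fix A :: "real set" and \<mu> :: "real measure"
    assume A: "A \<subseteq> {0..1}" "compact A" and supp: "supports A \<mu>" and en: "energy s (2 / 3) \<mu> = ennreal K"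
    assume "\<exists>\<epsilon>0. 0 < \<epsilon>0 \<and> \<epsilon>0 \<le> \<epsilon>_star \<and> (\<forall>x. \<forall>r>0. measure \<mu> (ball x r) \<le> C * r powr (1 - \<epsilon>0))"
    then obtain \<epsilon>0 where \<epsilon>0: "0 < \<epsilon>0" "\<epsilon>0 \<le> \<epsilon>_star"
      "\<And>x r. 0 < r \<Longrightarrow> measure \<mu> (ball x r) \<le> C * r powr (1 - \<epsilon>0)" by blast
    interpret real_distribution \<mu> using supp by (simp add: supports_def)
    note bounds = char_bounds_of_energy[OF \<open>s > 2 / 3\<close> \<open>K > 0\<close> en, folded \<kappa>_def B_def]
    from star(2)[OF A(2,1) supp bounds \<epsilon>0]
    obtain x t where "t \<noteq> 0" "{x, x - \<gamma>1 * t, x - \<gamma> * t} \<subseteq> A" by blast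
    thus "\<exists>x t. t \<noteq> 0 \<and> {x, x - \<gamma>1 * t, x - \<gamma>2 * t} \<subseteq> A"
      by (intro exI[of _ x] exI[of _ t]) (auto simp: \<gamma>_def split: if_splits)
  qed
qed

end
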